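(* Let $x\in V^0$ (i.e. $x\colon[0,+\infty)\to\mathbb{R}$ is càdlàg and piecewise monotonic), let $g:\mathbb{R}\to\mathbb{R}$ be Borel-measurable and locally integrable (with respect to Lebesgue measure), and define $f:\mathbb{R}\to\mathbb{R}$ by $f(y):=f_0+\int_{[0,y]}g(z)\,dz$ if $y\ge0$ and $f(y):=f_0-\int_{[y,0]}g(z)\,dz$ if $y<0$, with $f_0\in\mathbb{R}$; or, equivalently, let $f:\mathbb{R}\to\mathbb{R}$ be (locally) absolutely continuous with $f(y)=f(0)+\int_{[0,y]}g(z)\,dz=f(0)+\int_{[0,y]}f'(z)\,dz$ if $y\ge0$ and $f(y)=f(0)-\int_{[y,0]}g(z)\,dz=f(0)-\int_{[y,0]}f'(z)\,dz$ if $y<0$, for some Borel-measurable and locally integrable $g:\mathbb{R}\to\mathbb{R}$. Then for every $t>0$ \begin{align*} f(x_t)-f(x_0)&=\int_{\mathbb{R}}\{\mathrm{u}^{z}(x,[0,t])-\mathrm{d}^{z}(x,[0,t])\}\,g(z)\,dz\\ &=\int_{(0,t]}g(x_{s-})\,dx_{s}+\sum_{0<s\le t,\ \Delta x_{s}\neq0}\{f(x_{s})-f(x_{s-})-g(x_{s-})\Delta x_s\}\\ &=\int_{(0,t]}g(x_{s})\,dx^{cont}_{s}+\sum_{0<s\le t,\ \Delta x_{s}\neq0}\{f(x_{s})-f(x_{s-})\}\\ &=\int_{\mathbb{R}}\ell^z(t)\,g(z)\,dz+\sum_{0<s\le t,\ \Delta x_{s}\neq0}\{f(x_{s})-f(x_{s-})\}.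 \end{align*}
   Context: **Spaces.** $D$ is the set of càdlàg functions $x\colon[0,+\infty)\to\mathbb{R}$ (right-continuous on $[0,+\infty)$, with left limits $x_{s-}$ at every $s>0$); $x_s=x(s)$. $V\subset D$ is the subset of functions with locally finite total variation (finite total variation on every $[s,t]$, $0\le s<t<\infty$). $V^0\subset V$ is the set of piecewise monotonic functions: $x\in D$ such that for every $t>0$ there is a finite sequence of mutually disjoint intervals $I_1,\dots,I_N$ with $\bigcup_{i=1}^N I_i=[0,t]$ and $x$ monotone on each $I_i$. **Jumps and continuous part.** $\Delta x_s=x_s-x_{s-}$ for $s>0$. The continuous part $x^{cont}$ of $x\in V$ is defined by $x(t)=x^{cont}(t)+\sum_{0<s\le t}\Delta x_s$, $t\ge 0$. The integrals $\int h_s\,dx_s$ and $\int h_s\,dx^{cont}_s$ are Lebesgue–Stieltjes integrals. **Summation.** For a set $I$ and $b\colon I\to\mathbb{R}$, $\sum_{i\in I}b_i$ is the limit of the net of finite partial sums $\sum_{i\in\Gamma}b_i$, over finite $\Gamma\subseteq I$ directed by inclusion. **Interval crossings.** Let $y\in\mathbb{R}$, $c>0$, $x\in D$ and $0\le s<t$. Put $\sigma_0^c=s$ and, for $n=0,1,2,\dots$, $$\tau_n^c=\inf\{u\in[\sigma_n^c,t]: x(u)\ge y+c/2\},\qquad \sigma_{n+1}^c=\inf\{u\in[\tau_n^c,t]: x(u)<y-c/2\},$$ with the conventions $\inf\emptyset=+\infty$, $[+\infty,t]=\emptyset$. The number of downcrossings of $[y-c/2,y+c/2]$ by $x$ during $[s,t]$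 is $\mathrm{d}^{y,c}(x,[s,t]):=\max\{n:\sigma_n^c\le t\}$, and the number of upcrossings is $\mathrm{u}^{y,c}(x,[s,t]):=\mathrm{d}^{-y,c}(-x,[s,t])$. **Level crossings.** For $y\in\mathbb{R}$, with values in $\{0,1,2,\dots\}\cup\{+\infty\}$, $$\mathrm{d}^{y}(x,[s,t])=\lim_{c\to0+}\mathrm{d}^{y,c}(x,[s,t]),\qquad \mathrm{u}^{y}(x,[s,t])=\lim_{c\to0+}\mathrm{u}^{y,c}(x,[s,t]).$$ **Local time.** For $z\in\mathbb{R}$, $\mathcal{I}(z)$ is the set of $t>0$ such that $x$ is continuous at $t$, $x(t)=z$, and the sign of $x(t)-x(s)$ equals the sign of $t-s$ for all $s$ in some neighborhood of $t$. $\mathcal{D}(z)$ is the set of $t>0$ such that $x$ is continuous at $t$, $x(t)=z$, and the sign of $x(t)-x(s)$ equals the sign of $s-t$ for all $s$ in some neighborhood of $t$. Then $\ell^z(t)=\mathrm{Card}(\mathcal{I}(z)\cap(0,t])-\mathrm{Card}(\mathcal{D}(z)\cap(0,t])$. The differences defining $\ell^z(t)$ and $\mathrm{u}^z-\mathrm{d}^z$ are understood for Lebesgue-almost every $z$, where the terms are finite.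
   Formalization: The second line is stated only when g(x_{s-}) is Lebesgue–Stieltjes integrable with respect to dx on (0,t]; otherwise that integral and the accompanying sum can diverge (g is arbitrary on null sets while x may have infinitely many jumps). *)

theory Defs
  imports "HOL-Analysis.Analysis"
begin

section \<open>Paths\<close>

text \<open>A path on $[0,\infty)$ is a total function on the reals; none of the notions below
  depends on its values at negative arguments.\<close>

definition cadlag :: "(real \<Rightarrow> real) \<Rightarrow> bool" where
  "cadlag x \<longleftrightarrow> (\<forall>t\<ge>0. continuous (at_right t) x) \<and> (\<forall>t>0. \<exists>l. (x \<longlongrightarrow> l) (at_left t))"

text \<open>The intervals \<open>I i\<close> may be open, half-open, closed, degenerate or empty.\<close>

definition piecewise_monotonic :: "(real \<Rightarrow> real) \<Rightarrow> bool" where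
  "piecewise_monotonic x \<longleftrightarrow> cadlag x \<and>
     (\<forall>t>0. \<exists>(N::nat) I. (\<forall>i<N. is_interval (I i)) \<and> disjoint_family_on I {..<N} \<and>
        (\<Union>i<N. I i) = {0..t} \<and> (\<forall>i<N. mono_on (I i) x \<or> antimono_on (I i) x))"

definition left_lim :: "(real \<Rightarrow> real) \<Rightarrow> real \<Rightarrow> real" where
  "left_lim x s = Lim (at_left s) x"

definition jump :: "(real \<Rightarrow> real) \<Rightarrow> real \<Rightarrow> real" where
  "jump x s = x s - left_lim x s"

definition cont_part :: "(real \<Rightarrow> real) \<Rightarrow> real \<Rightarrow> real" where
  "cont_part x t = x t - (\<Sum>\<^sub>\<infinity>s\<in>{0<..t}. jump x s)"

section \<open>Lebesgue-Stieltjes integrals\<close>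

text \<open>The supremum in \<open>total_var\<close> is taken in the reals, so \<open>total_var x a b\<close> is meaningful only
  if \<open>x\<close> has finite variation on \<open>{a..b}\<close>.\<close>

definition total_var :: "(real \<Rightarrow> real) \<Rightarrow> real \<Rightarrow> real \<Rightarrow> real" where
  "total_var x a b =
     Sup {\<Sum>i<n. \<bar>x (p (Suc i)) - x (p i)\<bar> |(n::nat) p.
            (\<forall>i\<le>n. p i \<in> {a..b}) \<and> (\<forall>i<n. p i \<le> p (Suc i))}"

text \<open>The minimal (Jordan) decomposition $x_s - x_0 = P_s - N_s$ into nondecreasing functions. Both
  are extended by 0 to negative arguments, so that they induce measures on the whole line which do
  not charge $(-\infty,0]$. Right-continuity of \<open>P\<close> and \<open>N\<close>, which \<open>interval_measure\<close>
  presupposes, is inherited from \<open>x\<close>.\<close>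

definition pos_var :: "(real \<Rightarrow> real) \<Rightarrow> real \<Rightarrow> real" where
  "pos_var x s = (if 0 \<le> s then (total_var x 0 s + (x s - x 0)) / 2 else 0)"

definition neg_var :: "(real \<Rightarrow> real) \<Rightarrow> real \<Rightarrow> real" where
  "neg_var x s = (if 0 \<le> s then (total_var x 0 s - (x s - x 0)) / 2 else 0)"

text \<open>That is, \<open>h\<close> is integrable with respect to the total variation measure $|dx| = dP + dN$.
  Otherwise the library integrals below default to 0, so \<open>LS_integral\<close> is the Lebesgue-Stieltjes
  integral only under \<open>LS_integrable\<close>.\<close>

definition LS_integrable :: "(real \<Rightarrow> real) \<Rightarrow> real set \<Rightarrow> (real \<Rightarrow> real) \<Rightarrow> bool" where
  "LS_integrable x A h \<longleftrightarrow>
     set_integrable (interval_measure (pos_var x)) A h \<and>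
     set_integrable (interval_measure (neg_var x)) A h"

definition LS_integral :: "(real \<Rightarrow> real) \<Rightarrow> real set \<Rightarrow> (real \<Rightarrow> real) \<Rightarrow> real" where
  "LS_integral x A h =
     (LINT s:A|interval_measure (pos_var x). h s) - (LINT s:A|interval_measure (neg_var x). h s)"

section \<open>Interval and level crossings\<close>

text \<open>First time in $[r,t]$ at which \<open>Q\<close> holds, as an infimum; it is \<open>\<infinity>\<close> if there is no such time,
  in particular if \<open>r = \<infinity>\<close>.\<close>

definition inf_time :: "real \<Rightarrow> ereal \<Rightarrow> (real \<Rightarrow> bool) \<Rightarrow> ereal" where
  "inf_time t r Q = Inf (ereal ` {u. r \<le> ereal u \<and> u \<le> t \<and> Q u})"

text \<open>\<open>cross_time x y c s t n\<close> is $\sigma_n^c$; the intermediate time $\tau_n^c$ is the inner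
  \<open>inf_time\<close>.\<close>

primrec cross_time :: "(real \<Rightarrow> real) \<Rightarrow> real \<Rightarrow> real \<Rightarrow> real \<Rightarrow> real \<Rightarrow> nat \<Rightarrow> ereal" where
  "cross_time x y c s t 0 = ereal s"
| "cross_time x y c s t (Suc n) =
     inf_time t (inf_time t (cross_time x y c s t n) (\<lambda>u. x u \<ge> y + c / 2)) (\<lambda>u. x u < y - c / 2)"

definition interval_downcross ::
    "(real \<Rightarrow> real) \<Rightarrow> real \<Rightarrow> real \<Rightarrow> real \<Rightarrow> real \<Rightarrow> nat" where
  "interval_downcross x y c s t = Max {n. cross_time x y c s t n \<le> ereal t}"

definition interval_upcross ::
    "(real \<Rightarrow> real) \<Rightarrow> real \<Rightarrow> real \<Rightarrow> real \<Rightarrow> real \<Rightarrow> nat" where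
  "interval_upcross x y c s t = interval_downcross (\<lambda>u. - x u) (- y) c s t"

definition level_downcross :: "(real \<Rightarrow> real) \<Rightarrow> real \<Rightarrow> real \<Rightarrow> real \<Rightarrow> enat" where
  "level_downcross x y s t = Lim (at_right 0) (\<lambda>c. enat (interval_downcross x y c s t))"

definition level_upcross :: "(real \<Rightarrow> real) \<Rightarrow> real \<Rightarrow> real \<Rightarrow> real \<Rightarrow> enat" where
  "level_upcross x y s t = Lim (at_right 0) (\<lambda>c. enat (interval_upcross x y c s t))"

text \<open>Meaningful only where both terms are finite.\<close>

definition net_upcross :: "(real \<Rightarrow> real) \<Rightarrow> real \<Rightarrow> real \<Rightarrow> real \<Rightarrow> real" where
  "net_upcross x y s t =
     real (the_enat (level_upcross x y s t)) - real (the_enat (level_downcross x y s t))"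

section \<open>Local time\<close>

definition inc_times :: "(real \<Rightarrow> real) \<Rightarrow> real \<Rightarrow> real set" where
  "inc_times x z = {t. t > 0 \<and> isCont x t \<and> x t = z \<and>
     (\<forall>\<^sub>F s in nhds t. sgn (x t - x s) = sgn (t - s))}"

definition dec_times :: "(real \<Rightarrow> real) \<Rightarrow> real \<Rightarrow> real set" where
  "dec_times x z = {t. t > 0 \<and> isCont x t \<and> x t = z \<and>
     (\<forall>\<^sub>F s in nhds t. sgn (x t - x s) = sgn (s - t))}"

text \<open>Meaningful only if both sets are finite.\<close>

definition local_time :: "(real \<Rightarrow> real) \<Rightarrow> real \<Rightarrow> real \<Rightarrow> real" where
  "local_time x z t =
     real (card (inc_times x z \<inter> {0<..t})) - real (card (dec_times x z \<inter> {0<..t}))"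

end

(*
For a level z other than x(0) and x(t), upcrossings and downcrossings of z alternate, so their
difference only depends on the position of z relative to x(0) and x(t); this gives the first identity.

The other identities are additive in the time interval, so that it suffices to consider an interval
[a, b) on which x is monotone and, replacing x by -x, nondecreasing. There the generalized inverse of x
maps Lebesgue measure on (x(a), x(b-)) to dx. A value z is sent either to a jump time s, which happens
for almost all z between x(s-) and x(s) and accounts for the term f(x(s)) - f(x(s-)), or to a continuity
point s with x(s) = z, which (unless z belongs to a countable set) is the only point of increase of x at
the level z. The values of the second kind carry both the local time and the image of dx^cont.
*)
theory Submission
  imports Defs "HOL-Probability.Weak_Convergence"
begin

section \<open>Monotone pieces\<close>

text \<open>Right-continuity adds the left end point to a stretch of monotonicity, but nothing
  controls the value at the right end, where a jump may go against the direction of the piece. Hence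
  the half-open pieces, with the jump at \<open>b\<close> treated separately as an atom of
  \<open>{a<..b}\<close>: an increasing piece may end with a downward jump, which charges the
  negative variation.

  The second identity stands apart. As \<open>g\<close> is only locally integrable, its values on
  the countable set of left limits at jump times are arbitrary, and with infinitely many jumps
  \<open>g (left_lim x s)\<close> may fail to be integrable against \<open>dx\<close>. That integral
  therefore enters under a hypothesis. The integral against the continuous part and the local time
  integral always exist: on each piece both are, up to reflection, an integral of \<open>g\<close>
  over a bounded set of levels.

  Crossing counts and local time have a meaning only where they are finite. For the crossings this
  comes from a bound on alternations per piece, for the local time from a countable set of
  exceptional levels.\<close>

definition monotone_piece :: "(real \<Rightarrow> real) \<Rightarrow> real \<Rightarrow> real \<Rightarrow> bool" where
  "monotone_piece x a b \<longleftrightarrow> mono_on {a..<b} x \<or> antimono_on {a..<b} x"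

lemma monotone_piece_subset:
  assumes "monotone_piece x a b" "{c..<d} \<subseteq> {a..<b}"
  shows "monotone_piece x c d"
  using assms unfolding monotone_piece_def by (meson monotone_on_subset)

lemma monotone_piece_uminus [simp]: "monotone_piece (\<lambda>s. - x s) a b \<longleftrightarrow> monotone_piece x a b"
  by (auto simp: monotone_piece_def monotone_on_def)

lemma mono_on_atLeastLessThan_right_continuous:
  fixes x :: "real \<Rightarrow> real"
  assumes "mono_on {a<..<b} x" and rc: "continuous (at_right a) x"
  shows "mono_on {a..<b} x"
proof (rule mono_onI)
  fix u v assume uv: "u \<in> {a..<b}" "v \<in> {a..<b}" "u \<le> v"
  show "x u \<le> x v"
  proof (cases "u = a \<and> v \<noteq> a")
    case True
    have "(x \<longlongrightarrow> x a) (at_right a)" using rc by (simp add: continuous_within)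
    moreover have "\<forall>\<^sub>F s in at_right a. x s \<le> x v"
      using eventually_at_right_real[of a v] uv True
      by (force elim!: eventually_mono intro!: mono_onD[OF assms(1)])
    ultimately show ?thesis using True by (intro tendsto_upperbound) auto
  qed (use uv assms(1) in \<open>force simp: mono_on_def\<close>)
qed

lemma monotone_piece_right_continuous:
  assumes "mono_on {a<..<b} x \<or> antimono_on {a<..<b} x" "continuous (at_right a) x"
  shows "monotone_piece x a b"
proof -
  have "antimono_on {a..<b} x" if "antimono_on {a<..<b} x"
  proof -
    have "mono_on {a<..<b} (\<lambda>s. - x s)" using that by (auto simp: monotone_on_def)
    from mono_on_atLeastLessThan_right_continuous[OF this] show ?thesis
      using assms(2) by (auto simp: monotone_on_def intro!: continuous_intros)
  qed
  with mono_on_atLeastLessThan_right_continuous assms show ?thesis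
    unfolding monotone_piece_def by blast
qed

lemma frequently_eventually_witness:
  assumes "\<exists>\<^sub>F s in F. P s" "\<forall>\<^sub>F s in F. Q s"
  obtains s where "P s" "Q s"
proof -
  have "\<exists>s. P s \<and> Q s"
  proof (rule ccontr)
    assume "\<nexists>s. P s \<and> Q s"
    with assms(2) have "\<forall>\<^sub>F s in F. \<not> P s" by (auto elim: eventually_mono)
    with assms(1) show False by (simp add: frequently_def)
  qed
  thus ?thesis using that by blast
qed

text \<open>Finitely many intervals cover a right neighbourhood of \<open>u\<close>, so one of them
  has points arbitrarily close to \<open>u\<close> on the right. Being convex it contains some
  \<open>{u<..<p}\<close>, and right-continuity adds \<open>u\<close>.\<close>

lemma piecewise_monotonic_right_piece:
  assumes x: "piecewise_monotonic x" and u: "u \<ge> 0"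
  shows "\<exists>d>0. monotone_piece x u (u + d)"
proof -
  obtain N :: nat and I where I: "\<forall>i<N. is_interval (I i)" "(\<Union>i<N. I i) = {0..u+1}"
    "\<forall>i<N. mono_on (I i) x \<or> antimono_on (I i) x"
    using x u unfolding piecewise_monotonic_def
    by (metis add.commute add_strict_increasing zero_less_one)
  have "\<forall>\<^sub>F s in at_right u. \<exists>i\<in>{..<N}. s \<in> I i"
    using eventually_at_right_real[of u "u+1"] I(2) u
    by (force elim!: eventually_mono)
  hence "\<exists>\<^sub>F s in at_right u. \<exists>i\<in>{..<N}. s \<in> I i"
    by (intro eventually_frequently) auto
  then obtain i where i: "i < N" "\<exists>\<^sub>F s in at_right u. s \<in> I i"
    by (auto simp: frequently_bex_finite_distrib)
  obtain p where p: "p > u" "p \<in> I i"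
    using frequently_eventually_witness[OF i(2) eventually_at_right_less] by blast
  have sub: "{u<..<p} \<subseteq> I i"
  proof
    fix s assume s: "s \<in> {u<..<p}"
    obtain r where r: "u < r" "r < s" "r \<in> I i"
      using frequently_eventually_witness[OF i(2) eventually_at_right_real[of u s]] s by auto
    show "s \<in> I i" using I(1) i(1) p r s
      by (metis greaterThanLessThan_iff less_imp_le mem_is_interval_1_I)
  qed
  have "monotone_piece x u p"
  proof (rule monotone_piece_right_continuous)
    show "mono_on {u<..<p} x \<or> antimono_on {u<..<p} x"
      using I(3) i(1) sub monotone_on_subset by meson
    show "continuous (at_right u) x" using x u by (auto simp: piecewise_monotonic_def cadlag_def)
  qed
  thus ?thesis using p by (intro exI[of _ "p - u"]) auto
qed

lemma piecewise_monotonic_left_piece: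
  assumes x: "piecewise_monotonic x" and u: "u > 0"
  shows "\<exists>d>0. d \<le> u \<and> monotone_piece x (u - d) u"
proof -
  obtain N :: nat and I where I: "\<forall>i<N. is_interval (I i)" "(\<Union>i<N. I i) = {0..u}"
    "\<forall>i<N. mono_on (I i) x \<or> antimono_on (I i) x"
    using x u unfolding piecewise_monotonic_def by metis
  have "\<forall>\<^sub>F s in at_left u. \<exists>i\<in>{..<N}. s \<in> I i"
    using eventually_at_left_real[OF u] I(2) u
    by (force elim!: eventually_mono)
  hence "\<exists>\<^sub>F s in at_left u. \<exists>i\<in>{..<N}. s \<in> I i"
    by (intro eventually_frequently) auto
  then obtain i where i: "i < N" "\<exists>\<^sub>F s in at_left u. s \<in> I i"
    by (auto simp: frequently_bex_finite_distrib)
  obtain p where p: "p < u" "p \<in> I i"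
    using frequently_eventually_witness[OF i(2) eventually_at_left_real[OF u]] by auto
  have sub: "{p..<u} \<subseteq> I i"
  proof
    fix s assume s: "s \<in> {p..<u}"
    obtain r where r: "s < r" "r < u" "r \<in> I i"
      using frequently_eventually_witness[OF i(2) eventually_at_left_real[of s u]] s by auto
    show "s \<in> I i" using I(1) i(1) p r s
      by (metis atLeastLessThan_iff less_imp_le mem_is_interval_1_I)
  qed
  have "0 \<le> p" using I(2) p i(1) by force
  moreover have "monotone_piece x p u"
    using I(3) i(1) sub unfolding monotone_piece_def by (meson monotone_on_subset)
  ultimately show ?thesis using p by (intro exI[of _ "u - p"]) auto
qed

text \<open>Compactness replaces an ordered partition: the intervals in the definition come
  unordered and with end points of any type, while the Bolzano principle asks only for a monotone
  stretch on each side of every point.\<close>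

lemma piecewise_monotonic_induct [consumes 3, case_names piece join]:
  assumes x: "piecewise_monotonic x" and ab: "0 \<le> a" "a < b"
    and piece: "\<And>a b. 0 \<le> a \<Longrightarrow> a < b \<Longrightarrow> monotone_piece x a b \<Longrightarrow> Q a b"
    and join: "\<And>a b c. 0 \<le> a \<Longrightarrow> a < b \<Longrightarrow> b < c \<Longrightarrow> Q a b \<Longrightarrow> Q b c \<Longrightarrow> Q a c"
  shows "Q a b"
proof -
  \<comment> \<open>Around the point 0 the Bolzano principle also tests intervals that start at
    negative times, and it tests degenerate ones; the guard makes \<open>P\<close> trivial for
    them.\<close>
  define P where "P u v \<longleftrightarrow> (0 \<le> u \<and> u < v \<longrightarrow> Q u v)" for u v
  have "a \<le> b" using ab by simp
  hence "P a b"
  proof (induction rule: Bolzano)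
    case (trans u v w)
    thus ?case unfolding P_def using join by (metis antisym_conv1 dual_order.trans less_eq_real_def)
  next
    case (local u)
    have u: "0 \<le> u" using local ab by simp
    obtain d where d: "d > 0" "monotone_piece x u (u + d)"
      using piecewise_monotonic_right_piece[OF x u] by blast
    obtain e where e: "e > 0" "u > 0 \<Longrightarrow> monotone_piece x (u - e) u"
      using piecewise_monotonic_left_piece[OF x, of u] zero_less_one by (cases "u > 0") blast+
    show ?case
    proof (intro exI[of _ "min d e"] conjI allI impI)
      fix v w assume vw: "v \<le> u \<and> u \<le> w \<and> w - v < min d e"
      have 1: "Q v u" if "0 \<le> v" "v < u"
        using that vw e by (intro piece monotone_piece_subset[OF e(2)]) auto
      have 2: "Q u w" if "u < w"
        using that vw d u by (intro piece monotone_piece_subset[OF d(2)]) auto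
      show "P v w" unfolding P_def using 1 2 join vw by (metis order_le_less)
    qed (use d e in auto)
  qed
  thus ?thesis using ab by (simp add: P_def)
qed

section \<open>Alternating chains and level crossings\<close>

text \<open>A chain of \<open>m\<close> times in \<open>{s..w}\<close> on which \<open>X\<close> and \<open>Y\<close> hold alternately, read from the last time
  backwards: the last one satisfies \<open>X\<close>. Unlike the times \<open>cross_time\<close>, which need not be attained, such
  chains treat up- and downcrossings symmetrically.\<close>

primrec alternates :: "real \<Rightarrow> nat \<Rightarrow> (real \<Rightarrow> bool) \<Rightarrow> (real \<Rightarrow> bool) \<Rightarrow> real \<Rightarrow> bool" where
  "alternates s 0 X Y w \<longleftrightarrow> True"
| "alternates s (Suc m) X Y w \<longleftrightarrow> (\<exists>q. s \<le> q \<and> q \<le> w \<and> X q \<and> alternates s m Y X q)"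

lemma alternates_mono:
  assumes "alternates s m X Y w" "w \<le> w'"
    "\<And>u. s \<le> u \<Longrightarrow> u \<le> w \<Longrightarrow> X u \<Longrightarrow> X' u" "\<And>u. s \<le> u \<Longrightarrow> u \<le> w \<Longrightarrow> Y u \<Longrightarrow> Y' u"
  shows "alternates s m X' Y' w'"
  using assms
proof (induction m arbitrary: X Y X' Y' w w')
  case (Suc m)
  then obtain q where q: "s \<le> q" "q \<le> w" "X q" "alternates s m Y X q" by auto
  have "alternates s m Y' X' q" by (rule Suc.IH[OF q(4)]) (use Suc.prems q in auto)
  thus ?case using q Suc.prems by (auto intro!: exI[of _ q])
qed auto

lemma alternates_append:
  assumes "alternates s m X Y q" "s \<le> q" "q \<le> v" "v \<le> w" "Y q" "X v"
  shows "alternates s (Suc (Suc m)) X Y w"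
proof -
  have "alternates s (Suc m) Y X v" using assms by auto
  moreover have "s \<le> v" using assms by simp
  ultimately show ?thesis using assms by (subst alternates.simps(2)) blast
qed

lemma alternates_drop_first: "alternates s (Suc m) X Y w \<Longrightarrow> alternates s m X Y w"
proof (induction m arbitrary: X Y w)
  case (Suc m)
  then obtain q where "s \<le> q" "q \<le> w" "X q" "alternates s (Suc m) Y X q"
    unfolding alternates.simps(2)[of s "Suc m"] by blast
  with Suc.IH show ?case by (subst alternates.simps(2)) blast
qed simp

lemma alternates_drop_last: "alternates s (Suc m) X Y w \<Longrightarrow> alternates s m Y X w"
  by (auto intro: alternates_mono)

lemma alternates_drop_both: "alternates s (Suc (Suc m)) X Y w \<Longrightarrow> alternates s m Y X w"
  using alternates_drop_first alternates_drop_last by blast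

text \<open>The new earliest link has position \<open>m + 1\<close> counted from the end, and the
  odd positions carry \<open>X\<close>.\<close>

lemma alternates_prepend:
  "alternates s m X Y w \<Longrightarrow> s \<le> w \<Longrightarrow> (if even m then X s else Y s) \<Longrightarrow> alternates s (Suc m) X Y w"
proof (induction m arbitrary: X Y w)
  case (Suc m)
  then obtain q where q: "s \<le> q" "q \<le> w" "X q" "alternates s m Y X q" by auto
  have "alternates s (Suc m) Y X q" by (rule Suc.IH[OF q(4)]) (use Suc.prems q in auto)
  thus ?case using q by (subst alternates.simps) blast
qed auto

text \<open>The links after \<open>b\<close> form one chain and the remaining ones another. Which of
  \<open>X\<close> and \<open>Y\<close> the earlier chain ends with depends on the parity of
  \<open>k\<close>; the disjunction stands for this parity.\<close>

lemma alternates_split: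
  assumes "alternates a m X Y c" "a \<le> b"
  shows "\<exists>k l. m = k + l \<and> alternates b k X Y c \<and> (alternates a l X Y b \<or> alternates a l Y X b)"
  using assms
proof (induction m arbitrary: X Y c)
  case (Suc m)
  then obtain q where q: "a \<le> q" "q \<le> c" "X q" "alternates a m Y X q" by auto
  show ?case
  proof (cases "q \<le> b")
    case True
    have "alternates a (Suc m) X Y b" using q True by auto
    thus ?thesis by (intro exI[of _ 0] exI[of _ "Suc m"]) auto
  next
    case False
    from Suc.IH[OF q(4) Suc.prems(2)] obtain k l where kl: "m = k + l" "alternates b k Y X q"
      "alternates a l Y X b \<or> alternates a l X Y b" by blast
    have "alternates b (Suc k) X Y c" using kl q False by (auto intro!: exI[of _ q])
    thus ?thesis using kl by (intro exI[of _ "Suc k"] exI[of _ l]) (auto simp del: alternates.simps)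
  qed
qed auto

section \<open>First passage times and alternating chains\<close>

lemma inf_time_le: "r \<le> ereal u \<Longrightarrow> u \<le> t \<Longrightarrow> Q u \<Longrightarrow> inf_time t r Q \<le> ereal u"
  unfolding inf_time_def by (intro Inf_lower) auto

text \<open>An infimum equal to \<open>w\<close> may be approached only by times decreasing to
  \<open>w\<close>. The second hypothesis excludes this, so the infimum yields an actual time not
  later than \<open>w\<close>.\<close>

lemma inf_time_le_witness:
  assumes "inf_time t r Q \<le> ereal w" and "\<forall>\<^sub>F v in at_right w. \<not> Q v"
  obtains q where "r \<le> ereal q" "q \<le> w" "q \<le> t" "Q q"
proof -
  obtain e where e: "e > w" "\<And>v. w < v \<Longrightarrow> v < e \<Longrightarrow> \<not> Q v"
    using assms(2) by (auto simp: eventually_at_right_field)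
  have "inf_time t r Q < ereal e" using assms(1) e(1) by (metis ereal_less_eq(3) le_less_trans less_ereal.simps(1))
  then obtain q where q: "r \<le> ereal q" "q \<le> t" "Q q" "q < e"
    unfolding inf_time_def Inf_less_iff by auto
  moreover have "q \<le> w" using e q by (meson not_le)
  ultimately show ?thesis using that by blast
qed

lemma inf_time_finite_witness:
  assumes "inf_time t r Q \<le> ereal w"
  obtains q where "r \<le> ereal q" "q \<le> t" "Q q"
proof -
  have "inf_time t r Q < \<infinity>" using assms by (rule order_le_less_trans) simp
  thus ?thesis using that unfolding inf_time_def Inf_less_iff by auto
qed

lemma inf_time_ge: "r \<le> inf_time t r Q"
  unfolding inf_time_def by (auto intro: Inf_greatest)

context
  fixes x :: "real \<Rightarrow> real" and y c s t :: real
  assumes c: "c > 0" and rc: "\<And>u. u \<ge> s \<Longrightarrow> continuous (at_right u) x"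
begin

private abbreviation hi where "hi u \<equiv> x u \<ge> y + c / 2"
private abbreviation lo where "lo u \<equiv> x u < y - c / 2"

private lemma eventually_not_below:
  assumes "u \<ge> s" "hi u" shows "\<forall>\<^sub>F v in at_right u. \<not> lo v"
proof -
  have "(x \<longlongrightarrow> x u) (at_right u)" using rc[OF assms(1)] by (simp add: continuous_within)
  from order_tendstoD(1)[OF this, of "y - c/2"] show ?thesis using assms(2) c
    by (auto elim: eventually_mono)
qed

private lemma eventually_not_above:
  assumes "u \<ge> s" "lo u" shows "\<forall>\<^sub>F v in at_right u. \<not> hi v"
proof -
  have "(x \<longlongrightarrow> x u) (at_right u)" using rc[OF assms(1)] by (simp add: continuous_within)
  from order_tendstoD(2)[OF this, of "y + c/2"] show ?thesis using assms(2) c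
    by (auto elim: eventually_mono)
qed

private lemma cross_time_ge: "ereal s \<le> cross_time x y c s t n"
  by (induction n) (auto intro: inf_time_ge order_trans[OF _ inf_time_ge] order_trans[OF order_trans[OF _ inf_time_ge] inf_time_ge])

text \<open>The chain is built backwards from \<open>w\<close>. Where one threshold is met,
  right-continuity and the gap \<open>c > 0\<close> keep the other one unmet just to the right, so
  each infimum yields an actual time no later than the link already chosen.\<close>

private lemma cross_time_alternates_above:
  "cross_time x y c s t n \<le> ereal w \<Longrightarrow> w \<le> t \<Longrightarrow> hi w \<Longrightarrow> alternates s (2 * n) lo hi w"
proof (induction n arbitrary: w)
  case (Suc n)
  have sw: "s \<le> w" using cross_time_ge[of "Suc n"] Suc.prems(1)
    by (metis ereal_less_eq(3) order_trans)
  obtain v where v: "inf_time t (cross_time x y c s t n) hi \<le> ereal v" "v \<le> w" "v \<le> t" "lo v"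
    using inf_time_le_witness[OF Suc.prems(1)[unfolded cross_time.simps] eventually_not_below[OF sw Suc.prems(3)]] .
  have sv: "s \<le> v" using cross_time_ge[of n] inf_time_ge v(1)
    by (metis ereal_less_eq(3) order_trans)
  obtain q where q: "cross_time x y c s t n \<le> ereal q" "q \<le> v" "q \<le> t" "hi q"
    using inf_time_le_witness[OF v(1) eventually_not_above[OF sv v(4)]] .
  have "s \<le> q" using cross_time_ge[of n] q(1) by (metis ereal_less_eq(3) order_trans)
  thus ?case using alternates_append[OF Suc.IH[OF q(1,3,4)]] q v by simp
qed auto

lemma cross_time_le_iff_alternates:
  assumes "s \<le> t"
  shows "cross_time x y c s t n \<le> ereal t \<longleftrightarrow>
    alternates s (2 * n) (\<lambda>u. x u < y - c / 2) (\<lambda>u. x u \<ge> y + c / 2) t"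
proof
  assume le: "cross_time x y c s t n \<le> ereal t"
  show "alternates s (2 * n) lo hi t"
  proof (cases n)
    case (Suc m)
    \<comment> \<open>For the last low time the bound is \<open>t\<close>, and all times that enter
      the infimum are at most \<open>t\<close>; finiteness of the infimum is therefore
      enough.\<close>
    obtain v where v: "inf_time t (cross_time x y c s t m) hi \<le> ereal v" "v \<le> t" "lo v"
      using inf_time_finite_witness[of t _ lo t] le Suc by auto
    have sv: "s \<le> v" using cross_time_ge[of m] inf_time_ge v(1)
      by (metis ereal_less_eq(3) order_trans)
    obtain q where q: "cross_time x y c s t m \<le> ereal q" "q \<le> v" "q \<le> t" "hi q"
      using inf_time_le_witness[OF v(1) eventually_not_above[OF sv v(3)]] .
    have "s \<le> q" using cross_time_ge[of m] q(1) by (metis ereal_less_eq(3) order_trans)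
    thus ?thesis using alternates_append[OF cross_time_alternates_above[OF q(1,3,4)]] q v Suc by simp
  qed auto
next
  have "cross_time x y c s t n \<le> ereal w"
    if "alternates s (2 * n) lo hi w" "s \<le> w" "w \<le> t" for w
    using that
  proof (induction n arbitrary: w)
    case (Suc n)
    then obtain v q where vq: "s \<le> q" "q \<le> v" "v \<le> w" "lo v" "hi q"
      "alternates s (2 * n) lo hi q" by auto
    have "cross_time x y c s t n \<le> ereal q" using Suc.IH[OF vq(6)] vq Suc.prems by auto
    hence "inf_time t (cross_time x y c s t n) hi \<le> ereal q"
      by (rule inf_time_le) (use vq Suc.prems in auto)
    hence "inf_time t (cross_time x y c s t n) hi \<le> ereal v"
      using vq by (meson ereal_less_eq(3) order_trans)
    hence "cross_time x y c s t (Suc n) \<le> ereal v"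
      unfolding cross_time.simps by (rule inf_time_le) (use vq Suc.prems in auto)
    thus ?case using vq by (meson ereal_less_eq(3) order_trans)
  qed auto
  thus "alternates s (2 * n) lo hi t \<Longrightarrow> cross_time x y c s t n \<le> ereal t"
    using assms by blast
qed

end

text \<open>A chain has finitely many links, so the eventual statements at the single links can be
  combined.\<close>

lemma eventually_alternates:
  assumes "alternates s m X Y w"
    "\<And>u. X u \<Longrightarrow> \<forall>\<^sub>F c in F. X' c u" "\<And>u. Y u \<Longrightarrow> \<forall>\<^sub>F c in F. Y' c u"
  shows "\<forall>\<^sub>F c in F. alternates s m (X' c) (Y' c) w"
  using assms
proof (induction m arbitrary: X Y X' Y' w)
  case (Suc m)
  then obtain q where q: "s \<le> q" "q \<le> w" "X q" "alternates s m Y X q" by auto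
  have "\<forall>\<^sub>F c in F. alternates s m (Y' c) (X' c) q" by (rule Suc.IH[OF q(4)]) (use Suc.prems in auto)
  with Suc.prems(2)[OF q(3)] show ?case
    by eventually_elim (use q in auto)
qed auto

text \<open>Consecutive links occur at different times, so all but the latest lie in
  \<open>{a..<b}\<close>. Monotonicity admits only two links there, since a third would require a
  change of direction. The latest link may sit at \<open>b\<close>, behind the jump, which gives
  3.\<close>

lemma alternates_monotone_piece_bound:
  assumes "monotone_piece x a b" "alternates a m (\<lambda>u. x u < y) (\<lambda>u. y < x u) b \<or>
    alternates a m (\<lambda>u. y < x u) (\<lambda>u. x u < y) b"
  shows "m \<le> 3"
proof (rule ccontr)
  assume "\<not> m \<le> 3"
  then obtain k where k: "m = Suc (Suc (Suc (Suc k)))"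
    by (intro that[of "m - 4"]) simp
  obtain p q r s where pqrs: "a \<le> s" "s \<le> r" "r \<le> q" "q \<le> p" "p \<le> b"
    "(x p < y \<and> y < x q \<and> x r < y \<and> y < x s) \<or> (y < x p \<and> x q < y \<and> y < x r \<and> x s < y)"
    using assms(2) unfolding k by auto
  have "q < b" using pqrs by (metis less_eq_real_def not_less_iff_gr_or_eq order_trans)
  hence "q \<in> {a..<b}" "r \<in> {a..<b}" "s \<in> {a..<b}" using pqrs by auto
  hence "x s \<le> x r \<and> x r \<le> x q \<or> x r \<le> x s \<and> x q \<le> x r"
    using assms(1) pqrs by (auto simp: monotone_piece_def monotone_on_def)
  thus False using pqrs by linarith
qed

text \<open>Cutting a chain at \<open>b\<close> makes the bounds for the two halves add up. Both
  kinds of chains are bounded together because the earlier half may end on either side of the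
  level.\<close>

lemma piecewise_monotonic_alternates_bounded:
  assumes "piecewise_monotonic x" "0 \<le> a" "a < b"
  shows "\<exists>M. \<forall>m. alternates a m (\<lambda>u. x u < y) (\<lambda>u. y < x u) b \<or>
    alternates a m (\<lambda>u. y < x u) (\<lambda>u. x u < y) b \<longrightarrow> m \<le> M"
  using assms
proof (induction rule: piecewise_monotonic_induct)
  case (piece a b)
  thus ?case using alternates_monotone_piece_bound by blast
next
  case (join a b c)
  let ?A = "\<lambda>a m b. alternates a m (\<lambda>u. x u < y) (\<lambda>u. y < x u) b \<or>
    alternates a m (\<lambda>u. y < x u) (\<lambda>u. x u < y) b"
  obtain M N where M: "\<And>m. ?A a m b \<Longrightarrow> m \<le> M" and N: "\<And>m. ?A b m c \<Longrightarrow> m \<le> N"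
    using join by blast
  have "m \<le> N + M" if "?A a m c" for m
  proof -
    have "\<exists>k l. m = k + l \<and> ?A b k c \<and> ?A a l b"
      using that
    proof
      assume "alternates a m (\<lambda>u. x u < y) (\<lambda>u. y < x u) c"
      from alternates_split[OF this, of b] show ?thesis using \<open>a < b\<close> by force
    next
      assume "alternates a m (\<lambda>u. y < x u) (\<lambda>u. x u < y) c"
      from alternates_split[OF this, of b] show ?thesis using \<open>a < b\<close> by force
    qed
    then obtain k l where "m = k + l" "?A b k c" "?A a l b" by blast
    thus ?thesis using M[of l] N[of k] by linarith
  qed
  thus ?case by blast
qed

section \<open>Level crossings as maximal chains\<close>

definition alternation_count :: "real \<Rightarrow> (real \<Rightarrow> bool) \<Rightarrow> (real \<Rightarrow> bool) \<Rightarrow> real \<Rightarrow> nat" where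
  "alternation_count s X Y t = Max {n. alternates s (2 * n) X Y t}"

text \<open>The limit is attained. A longest chain for the level has finitely many links, each
  strictly off \<open>y\<close>, and so survives as a chain for the interval of width
  \<open>c\<close> once \<open>c\<close> is small. Conversely, a chain for the interval is always
  one for the level.\<close>

lemma level_downcross_eq:
  assumes rc: "\<And>u. u \<ge> s \<Longrightarrow> continuous (at_right u) x" and "s \<le> t"
    and fin: "finite {n. alternates s (2 * n) (\<lambda>u. x u < y) (\<lambda>u. y < x u) t}"
  shows "level_downcross x y s t = enat (alternation_count s (\<lambda>u. x u < y) (\<lambda>u. y < x u) t)"
proof -
  define S where "S = {n. alternates s (2 * n) (\<lambda>u. x u < y) (\<lambda>u. y < x u) t}"
  have "0 \<in> S" by (simp add: S_def)
  hence Max: "Max S \<in> S" using fin S_def by (metis Max_in empty_iff)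
  have "\<forall>\<^sub>F c in at_right (0::real). alternates s (2 * Max S) (\<lambda>u. x u < y - c / 2) (\<lambda>u. x u \<ge> y + c / 2) t"
  proof (rule eventually_alternates)
    fix u :: real
    show "x u < y \<Longrightarrow> \<forall>\<^sub>F c in at_right 0. x u < y - c / 2"
      by (rule eventually_at_rightI[of 0 "2 * (y - x u)"]) (auto simp: field_simps)
    show "y < x u \<Longrightarrow> \<forall>\<^sub>F c in at_right 0. y + c / 2 \<le> x u"
      by (rule eventually_at_rightI[of 0 "2 * (x u - y)"]) (auto simp: field_simps)
  qed (use Max in \<open>simp add: S_def\<close>)
  with eventually_at_right_less have "\<forall>\<^sub>F c in at_right 0. interval_downcross x y c s t = Max S"
  proof eventually_elim
    case (elim c)
    let ?S = "{n. cross_time x y c s t n \<le> ereal t}"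
    have "Max S \<in> ?S" using elim cross_time_le_iff_alternates[OF elim(1) rc \<open>s \<le> t\<close>] by simp
    moreover have "?S \<subseteq> S"
      using elim(1) cross_time_le_iff_alternates[OF elim(1) rc \<open>s \<le> t\<close>]
      by (auto simp: S_def elim!: alternates_mono)
    ultimately show ?case unfolding interval_downcross_def
      using fin unfolding S_def[symmetric] by (intro Max_eqI) (auto intro: finite_subset)
  qed
  hence "((\<lambda>c. enat (interval_downcross x y c s t)) \<longlongrightarrow> enat (Max S)) (at_right 0)"
    by (intro tendsto_eventually) (auto elim: eventually_mono)
  thus ?thesis unfolding level_downcross_def alternation_count_def S_def[symmetric]
    by (intro tendsto_Lim) auto
qed

lemma level_upcross_eq_downcross: "level_upcross x y s t = level_downcross (\<lambda>u. - x u) (- y) s t"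
  by (simp add: level_upcross_def level_downcross_def interval_upcross_def)

text \<open>The excluded levels ensure that times 0 and \<open>t\<close> can serve as links. If
  \<open>x 0 < y < x t\<close>, adding both end times turns \<open>n\<close> downcrossings into
  \<open>n + 1\<close> upcrossings, and dropping the outer links reverses this. If both ends lie on
  the same side, a link at one end of the chain is exchanged for one at the other end, so the counts
  agree.\<close>

lemma net_upcross_piecewise_monotonic:
  assumes x: "piecewise_monotonic x" and t: "t > 0" and y: "y \<noteq> x 0" "y \<noteq> x t"
  shows "level_upcross x y 0 t \<noteq> \<infinity>" "level_downcross x y 0 t \<noteq> \<infinity>"
    "net_upcross x y 0 t = indicator {x 0<..<x t} y - indicator {x t<..<x 0} y"
proof -
  let ?L = "\<lambda>u. x u < y" and ?U = "\<lambda>u. y < x u"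
  define D where "D = {n. alternates 0 (2 * n) ?L ?U t}"
  define U where "U = {n. alternates 0 (2 * n) ?U ?L t}"
  obtain M where M: "\<And>m. alternates 0 m ?L ?U t \<or> alternates 0 m ?U ?L t \<Longrightarrow> m \<le> M"
    using piecewise_monotonic_alternates_bounded[OF x _ t, of y] by blast
  have fin: "finite D" "finite U" unfolding D_def U_def
    using M by (force intro: finite_subset[of _ "{..M}"])+
  have rc: "continuous (at_right u) x" if "0 \<le> u" for u
    using x that by (auto simp: piecewise_monotonic_def cadlag_def)
  have down: "level_downcross x y 0 t = enat (Max D)"
    using level_downcross_eq[of 0 x t y] rc t fin by (simp add: alternation_count_def D_def)
  have up: "level_upcross x y 0 t = enat (Max U)"
    using level_downcross_eq[of 0 "\<lambda>u. - x u" t "- y"] rc t fin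
    unfolding level_upcross_eq_downcross by (simp add: alternation_count_def U_def continuous_minus)
  show "level_upcross x y 0 t \<noteq> \<infinity>" "level_downcross x y 0 t \<noteq> \<infinity>" using up down by auto
  have zero: "0 \<in> D" "0 \<in> U" by (auto simp: D_def U_def)
  have shift: "Max B = Suc (Max A)"
    if "finite A" "finite B" "0 \<in> A" "0 \<in> B" "\<And>n. n \<in> A \<longleftrightarrow> Suc n \<in> B" for A B :: "nat set"
  proof (rule Max_eqI)
    show "Suc (Max A) \<in> B" using that by (metis Max_in empty_iff)
    show "n \<le> Suc (Max A)" if "n \<in> B" for n
      using that \<open>finite A\<close> \<open>\<And>n. n \<in> A \<longleftrightarrow> Suc n \<in> B\<close> by (cases n) auto
  qed fact
  have t0: "0 \<le> t" using t by simp
  consider "x 0 < y" "y < x t" | "x t < y" "y < x 0" | "x 0 < y" "x t < y" | "y < x 0" "y < x t"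
    using y by linarith
  thus "net_upcross x y 0 t = indicator {x 0<..<x t} y - indicator {x t<..<x 0} y"
  proof cases
    case 1
    have "n \<in> D \<longleftrightarrow> Suc n \<in> U" for n
    proof
      assume "n \<in> D"
      hence "alternates 0 (Suc (2 * n)) ?L ?U t"
        unfolding D_def using 1 t0 by (intro alternates_prepend) auto
      hence "alternates 0 (Suc (Suc (2 * n))) ?U ?L t"
        using 1 t0 by (subst alternates.simps(2)) blast
      thus "Suc n \<in> U" by (simp add: U_def del: alternates.simps)
    next
      assume "Suc n \<in> U"
      hence "alternates 0 (Suc (Suc (2 * n))) ?U ?L t" by (simp add: U_def del: alternates.simps)
      from alternates_drop_both[OF this] show "n \<in> D" by (simp add: D_def)
    qed
    from shift[OF fin zero this] show ?thesis using 1 up down by (simp add: net_upcross_def)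
  next
    case 2
    have "n \<in> U \<longleftrightarrow> Suc n \<in> D" for n
    proof
      assume "n \<in> U"
      hence "alternates 0 (Suc (2 * n)) ?U ?L t"
        unfolding U_def using 2 t0 by (intro alternates_prepend) auto
      hence "alternates 0 (Suc (Suc (2 * n))) ?L ?U t"
        using 2 t0 by (subst alternates.simps(2)) blast
      thus "Suc n \<in> D" by (simp add: D_def del: alternates.simps)
    next
      assume "Suc n \<in> D"
      hence "alternates 0 (Suc (Suc (2 * n))) ?L ?U t" by (simp add: D_def del: alternates.simps)
      from alternates_drop_both[OF this] show "n \<in> U" by (simp add: U_def)
    qed
    from shift[OF fin(2,1) zero(2,1) this] show ?thesis using 2 up down by (simp add: net_upcross_def)
  next
    case 3
    have "D = U"
    proof (intro set_eqI iffI)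
      fix n assume "n \<in> U"
      show "n \<in> D"
      proof (cases n)
        case (Suc m)
        have "alternates 0 (Suc (2 * m)) ?U ?L t"
          using \<open>n \<in> U\<close> alternates_drop_first[of 0 "Suc (2 * m)"] by (simp add: U_def Suc)
        hence "alternates 0 (Suc (Suc (2 * m))) ?L ?U t"
          using 3 t0 by (subst alternates.simps(2)) blast
        thus ?thesis by (simp add: D_def Suc del: alternates.simps)
      qed (simp add: D_def)
    next
      fix n assume "n \<in> D"
      hence "alternates 0 (Suc (2 * n)) ?L ?U t"
        unfolding D_def using 3 t0 by (intro alternates_prepend) auto
      thus "n \<in> U" unfolding U_def using alternates_drop_last by blast
    qed
    thus ?thesis using 3 up down by (simp add: net_upcross_def)
  next
    case 4
    have "D = U"
    proof (intro set_eqI iffI)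
      fix n assume "n \<in> D"
      show "n \<in> U"
      proof (cases n)
        case (Suc m)
        have "alternates 0 (Suc (2 * m)) ?L ?U t"
          using \<open>n \<in> D\<close> alternates_drop_first[of 0 "Suc (2 * m)"] by (simp add: D_def Suc)
        hence "alternates 0 (Suc (Suc (2 * m))) ?U ?L t"
          using 4 t0 by (subst alternates.simps(2)) blast
        thus ?thesis by (simp add: U_def Suc del: alternates.simps)
      qed (simp add: U_def)
    next
      fix n assume "n \<in> U"
      hence "alternates 0 (Suc (2 * n)) ?U ?L t"
        unfolding U_def using 4 t0 by (intro alternates_prepend) auto
      thus "n \<in> D" unfolding D_def using alternates_drop_last by blast
    qed
    thus ?thesis using 4 up down by (simp add: net_upcross_def)
  qed
qed

section \<open>Total variation\<close>

definition variation_sums :: "(real \<Rightarrow> real) \<Rightarrow> real \<Rightarrow> real \<Rightarrow> real set" where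
  "variation_sums x a b = {\<Sum>i<n. \<bar>x (p (Suc i)) - x (p i)\<bar> |(n::nat) p.
            (\<forall>i\<le>n. p i \<in> {a..b}) \<and> (\<forall>i<n. p i \<le> p (Suc i))}"

text \<open>A witness of finite variation. The real \<open>Sup\<close> in \<open>total_var\<close>
  is informative only for a set bounded above; such a \<open>G\<close> supplies the bound by
  telescoping and is easily glued along adjacent intervals.\<close>

definition variation_majorant :: "(real \<Rightarrow> real) \<Rightarrow> (real \<Rightarrow> real) \<Rightarrow> real \<Rightarrow> real \<Rightarrow> bool" where
  "variation_majorant G x a b \<longleftrightarrow> (\<forall>u v. a \<le> u \<longrightarrow> u \<le> v \<longrightarrow> v \<le> b \<longrightarrow> \<bar>x v - x u\<bar> \<le> G v - G u)"

lemma variation_majorantD: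
  "variation_majorant G x a b \<Longrightarrow> a \<le> u \<Longrightarrow> u \<le> v \<Longrightarrow> v \<le> b \<Longrightarrow> \<bar>x v - x u\<bar> \<le> G v - G u"
  by (simp add: variation_majorant_def)

lemma variation_majorant_subset:
  "variation_majorant G x a b \<Longrightarrow> a \<le> c \<Longrightarrow> d \<le> b \<Longrightarrow> variation_majorant G x c d"
  by (simp add: variation_majorant_def)

lemma variation_majorant_join:
  assumes "variation_majorant G x a b" "variation_majorant H x b c" "a \<le> b" "b \<le> c"
  shows "variation_majorant (\<lambda>s. if s \<le> b then G s else G b + (H s - H b)) x a c"
  unfolding variation_majorant_def
proof (intro allI impI)
  fix u v assume uv: "a \<le> u" "u \<le> v" "v \<le> c"
  consider "v \<le> b" | "u \<le> b" "b < v" | "b < u" by linarith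
  thus "\<bar>x v - x u\<bar> \<le> (if v \<le> b then G v else G b + (H v - H b)) - (if u \<le> b then G u else G b + (H u - H b))"
  proof cases
    case 2
    have "\<bar>x v - x u\<bar> \<le> \<bar>x b - x u\<bar> + \<bar>x v - x b\<bar>" by linarith
    also have "\<dots> \<le> (G b - G u) + (H v - H b)"
      using 2 uv assms by (intro add_mono variation_majorantD[OF assms(1)] variation_majorantD[OF assms(2)]) auto
    finally show ?thesis using 2 by simp
  qed (use uv variation_majorantD[OF assms(1), of u v] variation_majorantD[OF assms(2), of u v] in auto)
qed

lemma zero_in_variation_sums:
  assumes "a \<le> b" shows "0 \<in> variation_sums x a b"
  unfolding variation_sums_def using assms
  by (auto intro!: exI[of _ "0::nat"] exI[of _ "\<lambda>_::nat. a"])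

lemma variation_sums_le:
  assumes "variation_majorant G x a b" "a \<le> b" "S \<in> variation_sums x a b"
  shows "S \<le> G b - G a"
proof -
  obtain n :: nat and p where p: "\<forall>i\<le>n. p i \<in> {a..b}" "\<forall>i<n. p i \<le> p (Suc i)"
    and S: "S = (\<Sum>i<n. \<bar>x (p (Suc i)) - x (p i)\<bar>)"
    using assms(3) unfolding variation_sums_def by blast
  have "S \<le> (\<Sum>i<n. G (p (Suc i)) - G (p i))"
    unfolding S using p by (intro sum_mono variation_majorantD[OF assms(1)]) auto
  also have "\<dots> = G (p n) - G (p 0)" by (rule sum_lessThan_telescope)
  also have "\<dots> \<le> G b - G a"
    using variation_majorantD[OF assms(1), of a "p 0"] variation_majorantD[OF assms(1), of "p n" b] p
    by force
  finally show ?thesis .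
qed

lemma total_var_le:
  assumes "variation_majorant G x a b" "a \<le> b"
  shows "total_var x a b \<le> G b - G a"
  unfolding total_var_def variation_sums_def[symmetric]
  using zero_in_variation_sums[OF assms(2)] variation_sums_le[OF assms] by (intro cSup_least) auto

lemma variation_sums_le_total_var:
  assumes "variation_majorant G x a b" "a \<le> b" "S \<in> variation_sums x a b"
  shows "S \<le> total_var x a b"
  unfolding total_var_def variation_sums_def[symmetric]
  using assms variation_sums_le[OF assms(1,2)] by (intro cSup_upper) (auto intro!: bdd_aboveI)

lemma total_var_append:
  assumes "variation_majorant G x a c" "a \<le> b" "b \<le> c"
  shows "total_var x a b + \<bar>x c - x b\<bar> \<le> total_var x a c"
proof -
  have "S \<le> total_var x a c - \<bar>x c - x b\<bar>" if S: "S \<in> variation_sums x a b" for S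
  proof -
    obtain n :: nat and p where p: "\<forall>i\<le>n. p i \<in> {a..b}" "\<forall>i<n. p i \<le> p (Suc i)"
      and S: "S = (\<Sum>i<n. \<bar>x (p (Suc i)) - x (p i)\<bar>)"
      using S unfolding variation_sums_def by blast
    \<comment> \<open>The partition is prolonged by \<open>b\<close> and \<open>c\<close>. Its last
      point \<open>p n\<close> may lie before \<open>b\<close>, so \<open>b\<close> has to be a node
      of its own.\<close>
    define q where "q i = (if i \<le> n then p i else if i = Suc n then b else c)" for i
    have "(\<Sum>i<Suc (Suc n). \<bar>x (q (Suc i)) - x (q i)\<bar>) \<in> variation_sums x a c"
      unfolding variation_sums_def using p assms
      by (auto intro!: exI[of _ "Suc (Suc n)"] exI[of _ q] simp: q_def less_Suc_eq le_Suc_eq)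
    moreover have "(\<Sum>i<Suc (Suc n). \<bar>x (q (Suc i)) - x (q i)\<bar>) = S + \<bar>x b - x (p n)\<bar> + \<bar>x c - x b\<bar>"
      unfolding S by (simp add: q_def)
    ultimately show ?thesis
      using variation_sums_le_total_var[OF assms(1), of S] variation_sums_le_total_var[OF assms(1)] assms
      by force
  qed
  hence "total_var x a b \<le> total_var x a c - \<bar>x c - x b\<bar>"
    unfolding total_var_def[of x a b] variation_sums_def[symmetric]
    using zero_in_variation_sums[OF assms(2)] by (intro cSup_least) auto
  thus ?thesis by simp
qed

lemma total_var_majorant:
  assumes "variation_majorant G x a b"
  shows "variation_majorant (total_var x a) x a b"
  unfolding variation_majorant_def
  using total_var_append[OF variation_majorant_subset[OF assms order_refl]] by force

lemma total_var_nonneg: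
  assumes "variation_majorant G x a b" "a \<le> b" shows "0 \<le> total_var x a b"
  using variation_sums_le_total_var[OF assms zero_in_variation_sums[OF assms(2)]] .

lemma total_var_mono:
  assumes "variation_majorant G x a c" "a \<le> b" "b \<le> c"
  shows "total_var x a b \<le> total_var x a c"
  using total_var_append[OF assms] by linarith

text \<open>Both inequalities use that the variation function is itself a majorant. For
  \<open>\<le>\<close> the variation functions from \<open>a\<close> and from \<open>b\<close>,
  glued at \<open>b\<close>, majorize \<open>x\<close> on \<open>{a..c}\<close>. For
  \<open>\<ge>\<close> the increments of \<open>total_var x a\<close> bound each variation sum over
  \<open>{b..c}\<close>.\<close>

lemma total_var_add:
  assumes "variation_majorant G x a c" "a \<le> b" "b \<le> c"
  shows "total_var x a c = total_var x a b + total_var x b c"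
proof (rule antisym)
  have "variation_majorant G x a b" "variation_majorant G x b c"
    using assms variation_majorant_subset by auto
  note G = this
  note H = variation_majorant_join[OF this[THEN total_var_majorant] assms(2,3)]
  have "total_var x b b \<ge> 0"
    using total_var_nonneg[OF variation_majorant_subset[OF assms(1), of b b]] assms by auto
  moreover have "total_var x a a \<ge> 0"
    using total_var_nonneg[OF variation_majorant_subset[OF assms(1), of a a]] assms by auto
  moreover have "total_var x a c \<le> (if c \<le> b then total_var x a c
     else total_var x a b + (total_var x b c - total_var x b b)) - total_var x a a"
    using total_var_le[OF H] assms by simp
  moreover have "total_var x b c \<ge> 0" using total_var_nonneg[OF G(2) assms(3)] .
  ultimately show "total_var x a c \<le> total_var x a b + total_var x b c"
    using assms by (cases "c \<le> b") auto
next
  have "S \<le> total_var x a c - total_var x a b" if S: "S \<in> variation_sums x b c" for S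
  proof -
    obtain n :: nat and p where p: "\<forall>i\<le>n. p i \<in> {b..c}" "\<forall>i<n. p i \<le> p (Suc i)"
      and S: "S = (\<Sum>i<n. \<bar>x (p (Suc i)) - x (p i)\<bar>)"
      using S unfolding variation_sums_def by blast
    have p_bounds: "b \<le> p i" "p i \<le> c" if "i \<le> n" for i using p(1) that by auto
    have "S \<le> (\<Sum>i<n. total_var x a (p (Suc i)) - total_var x a (p i))"
      unfolding S using p assms p_bounds
      by (intro sum_mono variation_majorantD[OF total_var_majorant[OF assms(1)]])
        (auto intro: order_trans[OF \<open>a \<le> b\<close>])
    also have "\<dots> = total_var x a (p n) - total_var x a (p 0)" by (rule sum_lessThan_telescope)
    also have "\<dots> \<le> total_var x a c - total_var x a b"
      using p assms by (intro diff_mono total_var_mono[OF variation_majorant_subset[OF assms(1)]]) force+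
    finally show ?thesis .
  qed
  hence "total_var x b c \<le> total_var x a c - total_var x a b"
    unfolding total_var_def[of x b c] variation_sums_def[symmetric]
    using zero_in_variation_sums[OF assms(3)] by (intro cSup_least) auto
  thus "total_var x a b + total_var x b c \<le> total_var x a c" by simp
qed

lemma total_var_uminus [simp]: "total_var (\<lambda>s. - x s) a b = total_var x a b"
proof -
  have "\<bar>- x u - - x v\<bar> = \<bar>x u - x v\<bar>" for u v by linarith
  thus ?thesis unfolding total_var_def by simp
qed

lemma total_var_mono_on:
  assumes "mono_on {a..b} x" "a \<le> b"
  shows "total_var x a b = x b - x a"
proof (rule antisym)
  have maj: "variation_majorant x x a b"
    using assms by (auto simp: variation_majorant_def monotone_on_def)
  show "total_var x a b \<le> x b - x a" by (rule total_var_le[OF maj assms(2)])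
  show "x b - x a \<le> total_var x a b"
    using total_var_append[OF maj order_refl assms(2)] 
      total_var_nonneg[OF variation_majorant_subset[OF maj order_refl assms(2)]] by simp
qed

lemma total_var_monotone:
  assumes "mono_on {a..b} x \<or> antimono_on {a..b} x" "a \<le> b"
  shows "total_var x a b = \<bar>x b - x a\<bar>"
  using assms(1)
proof
  assume "mono_on {a..b} x"
  thus ?thesis using total_var_mono_on assms(2) by (auto simp: monotone_on_def)
next
  assume *: "antimono_on {a..b} x"
  hence "mono_on {a..b} (\<lambda>s. - x s)" by (auto simp: monotone_on_def)
  from total_var_mono_on[OF this assms(2)] * assms(2) show ?thesis by (auto simp: monotone_on_def)
qed

lemma pos_var_uminus: "pos_var (\<lambda>s. - x s) = neg_var x"
  and neg_var_uminus: "neg_var (\<lambda>s. - x s) = pos_var x"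
  by (auto simp: pos_var_def neg_var_def fun_eq_iff)

section \<open>Paths of locally bounded variation and their Jordan decomposition\<close>

locale bv_path =
  fixes x :: "real \<Rightarrow> real"
  assumes finite_variation: "0 \<le> T \<Longrightarrow> \<exists>G. variation_majorant G x 0 T"
    and right_continuous: "0 \<le> u \<Longrightarrow> continuous (at_right u) x"
    and right_piece: "0 \<le> u \<Longrightarrow> \<exists>d>0. monotone_piece x u (u + d)"
begin

lemma bv_path_uminus: "bv_path (\<lambda>s. - x s)"
proof
  fix T :: real assume "0 \<le> T"
  then obtain G where "variation_majorant G x 0 T" using finite_variation by blast
  hence "variation_majorant G (\<lambda>s. - x s) 0 T" by (auto simp: variation_majorant_def abs_le_iff)
  thus "\<exists>G. variation_majorant G (\<lambda>s. - x s) 0 T" by blast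
qed (use right_continuous right_piece in \<open>auto intro: continuous_intros\<close>)

lemma total_var_diff:
  assumes "0 \<le> u" "u \<le> v"
  shows "total_var x 0 v = total_var x 0 u + total_var x u v"
proof -
  obtain G where "variation_majorant G x 0 v" using finite_variation assms by force
  from total_var_add[OF this assms] show ?thesis .
qed

lemma total_var_ge:
  assumes "0 \<le> u" "u \<le> v" shows "\<bar>x v - x u\<bar> \<le> total_var x u v"
proof -
  obtain G where "variation_majorant G x 0 v" using finite_variation assms by force
  hence "variation_majorant G x u v" using assms by (auto intro: variation_majorant_subset)
  from total_var_append[OF this order_refl assms(2)]
    total_var_nonneg[OF variation_majorant_subset[OF this order_refl assms(2)]]
  show ?thesis by simp
qed

lemma pos_var_diff:
  assumes "0 \<le> u" "u \<le> v"
  shows "pos_var x v - pos_var x u = (total_var x u v + (x v - x u)) / 2"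
  using total_var_diff[OF assms] assms by (simp add: pos_var_def field_simps)

lemma pos_var_nonpos: "s \<le> 0 \<Longrightarrow> pos_var x s = 0"
  using total_var_monotone[of 0 0 x] by (auto simp: pos_var_def monotone_on_def)

lemma pos_var_mono: "u \<le> v \<Longrightarrow> pos_var x u \<le> pos_var x v"
proof (cases "0 \<le> u")
  case True
  assume "u \<le> v"
  with True pos_var_diff[of u v] total_var_ge[of u v] show ?thesis by argo
next
  case False
  assume "u \<le> v"
  have "0 \<le> pos_var x v" if "0 \<le> v"
    using pos_var_diff[of 0 v] total_var_ge[of 0 v] that pos_var_nonpos[of 0] by argo
  thus ?thesis using False pos_var_nonpos[of u] pos_var_nonpos[of v] by fastforce
qed

text \<open>Just to the right of \<open>s\<close> the path is monotone, so its variation over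
  \<open>{s..v}\<close> is \<open>\<bar>x v - x s\<bar>\<close>, and the right-continuity of
  \<open>x\<close> carries over.\<close>

lemma pos_var_right_continuous: "continuous (at_right s) (pos_var x)"
proof (cases "0 \<le> s")
  case True
  then obtain d where d: "d > 0" "monotone_piece x s (s + d)" using right_piece by blast
  have "\<forall>\<^sub>F v in at_right s. v \<in> {s<..<s + d}" using d by (intro eventually_at_right_real) simp
  hence "\<forall>\<^sub>F v in at_right s. (\<bar>x v - x s\<bar> + (x v - x s)) / 2 + pos_var x s = pos_var x v"
  proof eventually_elim
    case (elim v)
    hence "mono_on {s..v} x \<or> antimono_on {s..v} x"
      using d(2) monotone_on_subset[of "{s..<s+d}" _ _ x "{s..v}"]
      unfolding monotone_piece_def by force
    from total_var_monotone[OF this] pos_var_diff[OF True, of v] elim show ?case by (auto simp: field_simps)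
  qed
  moreover have "((\<lambda>v. (\<bar>x v - x s\<bar> + (x v - x s)) / 2 + pos_var x s) \<longlongrightarrow> 
    (\<bar>x s - x s\<bar> + (x s - x s)) / 2 + pos_var x s) (at_right s)"
    using right_continuous[OF True] unfolding continuous_within by (intro tendsto_intros) auto
  ultimately show ?thesis unfolding continuous_within
    by (auto elim: Lim_transform_eventually)
next
  case False
  hence "\<forall>\<^sub>F v in at_right s. pos_var x s = pos_var x v"
    using eventually_at_right_real[of s 0] pos_var_nonpos by (force elim: eventually_mono)
  thus ?thesis unfolding continuous_within by (rule Lim_transform_eventually[OF tendsto_const])
qed

lemma pos_var_mono_on:
  assumes "mono_on {u..v} x" "0 \<le> u" "u \<le> v"
  shows "pos_var x v - pos_var x u = x v - x u" "neg_var x v - neg_var x u = 0"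
  using total_var_mono_on[OF assms(1,3)] pos_var_diff[OF assms(2,3)] total_var_diff[OF assms(2,3)] assms
  by (auto simp: neg_var_def field_simps)

lemma neg_var_mono: "u \<le> v \<Longrightarrow> neg_var x u \<le> neg_var x v"
  and neg_var_right_continuous: "continuous (at_right s) (neg_var x)"
  using bv_path.pos_var_mono[OF bv_path_uminus] bv_path.pos_var_right_continuous[OF bv_path_uminus]
  by (simp_all add: pos_var_uminus)

lemma pos_var_minus_neg_var: "0 \<le> s \<Longrightarrow> pos_var x s - neg_var x s = x s - x 0"
  by (simp add: pos_var_def neg_var_def field_simps)

end

section \<open>Measures and integrals\<close>

text \<open>Countable additivity gives the value along one enumeration, whereas
  \<open>has_sum\<close> demands unconditional convergence. The latter follows because all finite
  sums of the integrals of \<open>\<bar>g\<bar>\<close> are at most its integral over the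
  union.\<close>

lemma has_sum_set_integral_UN:
  fixes g :: "'a \<Rightarrow> real"
  assumes I: "countable I" and A: "\<And>i. i \<in> I \<Longrightarrow> A i \<in> sets M" "disjoint_family_on A I"
    and g: "set_integrable M (\<Union>i\<in>I. A i) g"
  shows "((\<lambda>i. LINT x:A i|M. g x) has_sum (LINT x:(\<Union>i\<in>I. A i)|M. g x)) I"
proof -
  have UN: "(\<Union>i\<in>F. A i) \<in> sets M" if "F \<subseteq> I" for F
    using that A(1) countable_subset[OF that I] by (intro sets.countable_UN') auto
  have gi: "set_integrable M (A i) g" if "i \<in> I" for i
    using that by (intro set_integrable_subset[OF g A(1)]) auto
  show ?thesis
  proof (cases "finite I")
    case True
    thus ?thesis using A gi by (intro has_sum_finiteI) (auto simp: set_integral_finite_Union)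
  next
    case False
    have sum_abs: "(\<lambda>i. LINT x:A i|M. \<bar>g x\<bar>) summable_on I"
    proof (rule nonneg_bdd_above_summable_on)
      show "0 \<le> (LINT x:A i|M. \<bar>g x\<bar>)" for i
        unfolding set_lebesgue_integral_def by (auto intro: integral_nonneg_AE)
      show "bdd_above (sum (\<lambda>i. LINT x:A i|M. \<bar>g x\<bar>) ` {F. F \<subseteq> I \<and> finite F})"
      proof (rule bdd_aboveI2)
        fix F assume F: "F \<in> {F. F \<subseteq> I \<and> finite F}"
        have "(\<Sum>i\<in>F. LINT x:A i|M. \<bar>g x\<bar>) = (LINT x:(\<Union>i\<in>F. A i)|M. \<bar>g x\<bar>)"
          using F A gi disjoint_family_on_mono[OF _ A(2), of F]
          by (intro set_integral_finite_Union[symmetric]) (auto intro: set_integrable_abs)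
        also have "\<dots> \<le> (LINT x:(\<Union>i\<in>I. A i)|M. \<bar>g x\<bar>)"
          unfolding set_lebesgue_integral_def
        proof (rule integral_mono)
          show "integrable M (\<lambda>x. indicat_real (\<Union>i\<in>F. A i) x *\<^sub>R \<bar>g x\<bar>)"
            using set_integrable_abs[OF set_integrable_subset[OF g UN, of F]] F
            by (auto simp: set_integrable_def)
          show "integrable M (\<lambda>x. indicat_real (\<Union>i\<in>I. A i) x *\<^sub>R \<bar>g x\<bar>)"
            using set_integrable_abs[OF g] by (auto simp: set_integrable_def)
        qed (use F in \<open>auto split: split_indicator\<close>)
        finally show "(\<Sum>i\<in>F. LINT x:A i|M. \<bar>g x\<bar>) \<le> (LINT x:(\<Union>i\<in>I. A i)|M. \<bar>g x\<bar>)" .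
      qed
    qed
    have norm_le: "norm (LINT x:A i|M. g x) \<le> (LINT x:A i|M. \<bar>g x\<bar>)" if "i \<in> I" for i
    proof -
      have "norm (LINT x:A i|M. g x) \<le> (LINT x|M. norm (indicator (A i) x *\<^sub>R g x))"
        unfolding set_lebesgue_integral_def by (rule integral_norm_bound)
      thus ?thesis by (simp add: set_lebesgue_integral_def abs_mult)
    qed
    have "(\<lambda>i. norm (LINT x:A i|M. g x)) summable_on I"
      by (rule summable_on_comparison_test[OF sum_abs norm_le]) simp_all
    hence "(\<lambda>i. LINT x:A i|M. g x) summable_on I" by (rule abs_summable_summable)
    then obtain S where S: "((\<lambda>i. LINT x:A i|M. g x) has_sum S) I"
      by (auto simp: summable_on_def)
    define e where "e = from_nat_into I"
    have e: "bij_betw e UNIV I" unfolding e_def using I False by (rule bij_betw_from_nat_into)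
    have "((\<lambda>n. LINT x:A (e n)|M. g x) has_sum S) UNIV"
      using S has_sum_reindex_bij_betw[OF e, of "\<lambda>i. LINT x:A i|M. g x"] by simp
    hence "(\<Sum>n. LINT x:A (e n)|M. g x) = S" by (intro sums_unique[symmetric] has_sum_imp_sums)
    moreover have "(\<Union>n. A (e n)) = (\<Union>i\<in>I. A i)" using e by (auto simp: bij_betw_def)
    moreover have "(LINT x:(\<Union>n. A (e n))|M. g x) = (\<Sum>n. LINT x:A (e n)|M. g x)"
    proof (rule lebesgue_integral_countable_add)
      have eI: "e n \<in> I" for n using e by (auto simp: bij_betw_def)
      show "A (e n) \<in> sets M" for n using eI A(1) by auto
      show "A (e i) \<inter> A (e j) = {}" if "i \<noteq> j" for i j
      proof -
        have "e i \<noteq> e j" using e that by (auto simp: bij_betw_def inj_on_def)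
        with A(2) eI show ?thesis unfolding disjoint_family_on_def by blast
      qed
    qed (use g calculation in simp)
    ultimately show ?thesis using S by simp
  qed
qed

text \<open>Increments are compared only for \<open>v < b\<close>, because a piece excludes
  \<open>b\<close>, and elsewhere the two measures may differ. Uniqueness on the half-open intervals
  is therefore applied to the restrictions to \<open>{a<..w}\<close>, where the mass is finite, and
  then \<open>w\<close> increases to \<open>b\<close>.\<close>

lemma emeasure_interval_measure_eqI:
  assumes mono: "\<And>u v. u \<le> v \<Longrightarrow> F u \<le> F v" and rc: "\<And>s. continuous (at_right s) F"
    and ab: "a < b" and N: "sets N = sets borel"
    and eq: "\<And>u v. a \<le> u \<Longrightarrow> u \<le> v \<Longrightarrow> v < b \<Longrightarrow> emeasure N {u<..v} = ennreal (F v - F u)"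
    and A: "A \<in> sets borel" "A \<subseteq> {a<..<b}"
  shows "emeasure (interval_measure F) A = emeasure N A"
proof -
  let ?M = "interval_measure F"
  have Ioc: "emeasure ?M {u<..v} = ennreal (F v - F u)" if "u \<le> v" for u v
    using emeasure_interval_measure_Ioc[OF that mono rc] by simp
  have *: "emeasure ?M (A \<inter> {a<..w}) = emeasure N (A \<inter> {a<..w})" if w: "a \<le> w" "w < b" for w
  proof -
    let ?D = "\<lambda>K. density K (indicator {a<..w} :: real \<Rightarrow> ennreal)"
    have D: "emeasure (?D ?M) X = emeasure ?M ({a<..w} \<inter> X)"
      "emeasure (?D N) X = emeasure N ({a<..w} \<inter> X)" if "X \<in> sets borel" for X
      using that N by (simp_all add: emeasure_restricted)
    have "?D ?M = ?D N"
    proof (rule measure_eqI_generator_eq)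
      let ?E = "range (\<lambda>(u, v). {u<..v::real})"
      show "Int_stable ?E"
        by (auto simp: Int_stable_def)
      show "emeasure (?D ?M) X = emeasure (?D N) X" if X: "X \<in> ?E" for X
      proof -
        obtain u v where uv: "X = {u<..v}" using X by auto
        have "{a<..w} \<inter> X = {max a u<..min w v}" using uv by auto
        thus ?thesis
          using w eq[of "max a u" "min w v"] Ioc[of "max a u" "min w v"] uv
          by (cases "max a u \<le> min w v") (auto simp: D)
      qed
      show "sets (?D ?M) = sigma_sets UNIV ?E" "sets (?D N) = sigma_sets UNIV ?E"
        using N by (simp_all add: borel_sigma_sets_Ioc)
      show "range (\<lambda>n::nat. {- real n<..real n}) \<subseteq> ?E" by auto
      show "(\<Union>n::nat. {- real n<..real n}) = UNIV"
      proof (intro equalityI subsetI UNIV_I)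
        fix y :: real
        obtain n :: nat where "\<bar>y\<bar> < real n" using reals_Archimedean2 by blast
        thus "y \<in> (\<Union>n::nat. {- real n<..real n})" by (intro UN_I[of n]) auto
      qed
      have le: "emeasure ?M ({a<..w} \<inter> X) \<le> ennreal (F w - F a)" for X
        using emeasure_mono[of "{a<..w} \<inter> X" "{a<..w}" ?M] Ioc[OF w(1)] by simp
      thus "emeasure (?D ?M) {- real n<..real n} \<noteq> \<infinity>" for n
        using neq_top_trans[OF ennreal_neq_top le[of "{- real n<..real n}"]] by (simp add: D)
    qed auto
    hence "emeasure (?D ?M) A = emeasure (?D N) A" by simp
    thus ?thesis using A by (simp add: D Int_commute)
  qed
  define w where "w n = b - (b - a) * inverse (real (Suc n))" for n
  have w: "a \<le> w n" "w n < b" for n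
    using ab by (auto simp: w_def field_simps intro: mult_right_mono)
  have "incseq w" unfolding w_def using ab
    by (auto intro!: incseq_SucI simp: field_simps)
  hence inc: "incseq (\<lambda>n. A \<inter> {a<..w n})"
    by (force simp: incseq_def intro: order_trans)
  have "w \<longlonglongrightarrow> b - (b - a) * 0"
    unfolding w_def by (intro tendsto_intros LIMSEQ_inverse_real_of_nat)
  hence "w \<longlonglongrightarrow> b" by simp
  have UN: "(\<Union>n. A \<inter> {a<..w n}) = A"
  proof
    show "A \<subseteq> (\<Union>n. A \<inter> {a<..w n})"
    proof
      fix y assume y: "y \<in> A"
      hence "y < b" using A by auto
      from order_tendstoD(1)[OF \<open>w \<longlonglongrightarrow> b\<close> this] obtain n where "y < w n"
        by (auto simp: eventually_sequentially)
      thus "y \<in> (\<Union>n. A \<inter> {a<..w n})" using y A by (intro UN_I[of n]) auto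
    qed
  qed auto
  have "(\<lambda>n. emeasure K (A \<inter> {a<..w n})) \<longlonglongrightarrow> emeasure K A" if "sets K = sets borel" for K
  proof -
    have "range (\<lambda>n. A \<inter> {a<..w n}) \<subseteq> sets K"
      using A(1) unfolding that by (intro image_subsetI sets.Int) simp_all
    from Lim_emeasure_incseq[OF this inc] UN show ?thesis by simp
  qed
  from this[of ?M] this[of N] N *[OF w] show ?thesis
    by (auto intro: LIMSEQ_unique)
qed

lemma emeasure_interval_measure_singleton:
  assumes mono: "\<And>u v. u \<le> v \<Longrightarrow> F u \<le> F v" and rc: "\<And>s. continuous (at_right s) F"
    and L: "(F \<longlongrightarrow> L) (at_left b)"
  shows "emeasure (interval_measure F) {b} = ennreal (F b - L)"
proof -
  define w where "w n = b - inverse (real (Suc n))" for n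
  have "w \<longlonglongrightarrow> b - 0"
    unfolding w_def by (intro tendsto_intros LIMSEQ_inverse_real_of_nat)
  hence lim: "w \<longlonglongrightarrow> b" by simp
  have wb: "w n < b" for n by (simp add: w_def)
  have "filterlim w (at_left b) sequentially"
    using lim wb by (auto simp: filterlim_at intro: always_eventually)
  hence "(\<lambda>n. F (w n)) \<longlonglongrightarrow> L" by (rule filterlim_compose[OF L])
  hence "(\<lambda>n. ennreal (F b - F (w n))) \<longlonglongrightarrow> ennreal (F b - L)" by (intro tendsto_intros)
  moreover have Ioc: "emeasure (interval_measure F) {w n<..b} = ennreal (F b - F (w n))" for n
    using emeasure_interval_measure_Ioc[OF less_imp_le[OF wb] mono rc] by simp
  moreover have "(\<lambda>n. emeasure (interval_measure F) {w n<..b}) \<longlonglongrightarrow> emeasure (interval_measure F) (\<Inter>n. {w n<..b})"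
  proof (rule Lim_emeasure_decseq)
    have "incseq w" unfolding w_def by (auto intro!: incseq_SucI simp: field_simps)
    thus "decseq (\<lambda>n. {w n<..b})" by (force simp: decseq_def incseq_def intro: order_le_less_trans)
  qed (auto simp: Ioc)
  moreover have "(\<Inter>n. {w n<..b}) = {b}"
  proof (intro equalityI subsetI)
    fix y assume y: "y \<in> (\<Inter>n. {w n<..b})"
    hence "b \<le> y" by (intro LIMSEQ_le_const2[OF lim]) (auto intro: less_imp_le)
    thus "y \<in> {b}" using y by auto
  qed (use wb in auto)
  ultimately show ?thesis by (auto intro: LIMSEQ_unique)
qed

text \<open>The hypothesis on measures says that \<open>M\<close> on \<open>A\<close> is the image
  under \<open>I\<close> of Lebesgue measure on \<open>W\<close>, so both claims are the
  transformation rule for image measures. Restricted spaces appear because \<open>I\<close> is known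
  to be measurable only on \<open>W\<close>, and \<open>h\<close> only on \<open>A\<close>.\<close>

lemma
  fixes h :: "real \<Rightarrow> real"
  assumes M: "sets M = sets borel" and A: "A \<in> sets borel" and O: "W \<in> sets borel"
    and I: "I \<in> borel_measurable (restrict_space borel W)" "I ` W \<subseteq> A"
    and eq: "\<And>B. B \<in> sets borel \<Longrightarrow> B \<subseteq> A \<Longrightarrow> emeasure M B = emeasure lborel (W \<inter> I -` B)"
    and h: "set_borel_measurable borel A h"
  shows set_integrable_transport: "set_integrable M A h \<longleftrightarrow> set_integrable lborel W (\<lambda>z. h (I z))"
    and set_integral_transport: "(LINT s:A|M. h s) = (LINT z:W|lborel. h (I z))"
proof -
  define R where "R = restrict_space lborel W"
  have spaces: "space M = UNIV" "A \<inter> space M \<in> sets M" "W \<inter> space lborel \<in> sets lborel"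
    using M A O sets_eq_imp_space_eq[OF M] by auto
  have I': "I \<in> measurable R (restrict_space M A)"
  proof (rule measurable_restrict_space2)
    show "I \<in> space R \<rightarrow> A" using I(2) by (auto simp: R_def space_restrict_space)
    have "sets R = sets (restrict_space borel W)" by (simp add: R_def sets_restrict_space)
    thus "I \<in> measurable R M" using I(1) M by (simp cong: measurable_cong_sets)
  qed
  have "restrict_space M A = distr R (restrict_space M A) I"
  proof (rule measure_eqI)
    fix B assume "B \<in> sets (restrict_space M A)"
    moreover from this have B: "B \<in> sets borel" "B \<subseteq> A"
      using A M by (auto simp: sets_restrict_space)
    ultimately have "emeasure (distr R (restrict_space M A) I) B = emeasure R (I -` B \<inter> W)"
      using I' by (subst emeasure_distr) (auto simp: R_def space_restrict_space)
    also have "\<dots> = emeasure lborel (W \<inter> I -` B)"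
      unfolding R_def using spaces by (subst emeasure_restrict_space) (auto simp: Int_commute)
    also have "\<dots> = emeasure (restrict_space M A) B"
      using B spaces eq by (subst emeasure_restrict_space) auto
    finally show "emeasure (restrict_space M A) B = emeasure (distr R (restrict_space M A) I) B" by simp
  qed simp
  note D = this
  have h': "h \<in> borel_measurable (restrict_space M A)"
    using h M A spaces borel_measurable_restrict_space_iff[of A M h]
    by (simp add: set_borel_measurable_def cong: measurable_cong_sets)
  have "set_integrable M A h \<longleftrightarrow> integrable (restrict_space M A) h"
    unfolding set_integrable_def using spaces by (simp add: integrable_restrict_space)
  also have "\<dots> \<longleftrightarrow> integrable R (\<lambda>z. h (I z))"
    using integrable_distr_eq[OF I' h'] D by simp
  also have "\<dots> \<longleftrightarrow> set_integrable lborel W (\<lambda>z. h (I z))"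
    unfolding set_integrable_def R_def using spaces by (simp add: integrable_restrict_space)
  finally show "set_integrable M A h \<longleftrightarrow> set_integrable lborel W (\<lambda>z. h (I z))" .
  have "(LINT s:A|M. h s) = (LINT s|restrict_space M A. h s)"
    unfolding set_lebesgue_integral_def using spaces by (simp add: integral_restrict_space)
  also have "\<dots> = (LINT z|R. h (I z))"
    using integral_distr[OF I' h'] D by simp
  also have "\<dots> = (LINT z:W|lborel. h (I z))"
    unfolding set_lebesgue_integral_def R_def using spaces by (simp add: integral_restrict_space)
  finally show "(LINT s:A|M. h s) = (LINT z:W|lborel. h (I z))" .
qed

text \<open>The exceptional set is required to be countable rather than null because \<open>lborel\<close> is not complete:
  measurability of \<open>f\<close> would not pass to \<open>g\<close>.\<close>

lemma has_bochner_integral_lborel_countable_difference: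
  fixes f g :: "real \<Rightarrow> real"
  assumes f: "has_bochner_integral lborel f c" and X: "countable X"
    and eq: "\<And>z. z \<notin> X \<Longrightarrow> f z = g z"
  shows "has_bochner_integral lborel g c"
proof -
  have "f \<in> borel_measurable lborel" using f by (rule borel_measurable_has_bochner_integral)
  moreover from this have "g \<in> borel_measurable lborel"
    by (rule measurable_discrete_difference[of _ _ _ X]) (use X eq in auto)
  moreover have "AE z in lborel. f z = g z"
    using AE_not_in[OF countable_imp_null_set_lborel[OF X]] eq by (auto elim: eventually_mono)
  ultimately show ?thesis using f has_bochner_integral_cong_AE by blast
qed

section \<open>The inverse of a monotone piece\<close>

text \<open>Only increments of \<open>f\<close> enter. This form has no base point and no case
  distinction at 0, and it is stable under reflection of the levels.\<close>

locale primitive =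
  fixes f g :: "real \<Rightarrow> real"
  assumes borel [measurable]: "g \<in> borel_measurable borel"
    and integrable_Icc: "set_integrable lborel {u..v} g"
    and diff_eq: "u \<le> v \<Longrightarrow> f v - f u = (LINT z:{u..v}|lborel. g z)"
begin

lemma integrable_subset_Icc:
  assumes "S \<in> sets borel" "S \<subseteq> {u..v}" shows "set_integrable lborel S g"
  using set_integrable_subset[OF integrable_Icc] assms by auto

end

text \<open>With this choice the formulas for sums of \<open>f (x s) - f (left_lim x s)\<close>
  become formulas for the jumps of \<open>x\<close> themselves.\<close>

lemma primitive_id: "primitive (\<lambda>z. z) (\<lambda>_. 1)"
proof
  fix u v :: real
  show "set_integrable lborel {u..v} (\<lambda>_. 1::real)"
    by (simp add: set_integrable_def integrable_indicator_iff emeasure_lborel_Icc_eq)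
  show "v - u = (LINT z:{u..v}|lborel. 1)" if "u \<le> v"
    using that by (simp add: set_lebesgue_integral_def)
qed simp

lemma set_integral_lborel_sandwich:
  fixes g :: "real \<Rightarrow> real"
  assumes "{u<..<v} \<subseteq> S" "S \<subseteq> {u..v}" and [measurable]: "S \<in> sets borel" "g \<in> borel_measurable borel"
  shows "(LINT z:S|lborel. g z) = (LINT z:{u..v}|lborel. g z)"
proof (rule set_integral_cong_set)
  show "AE z in lborel. (z \<in> {u..v}) = (z \<in> S)"
    using AE_lborel_singleton[of u] AE_lborel_singleton[of v]
    by eventually_elim (use assms in force)
qed (simp_all add: set_borel_measurable_def)

lemma isCont_iff_jump_0:
  assumes "continuous (at_right s) x" "(x \<longlongrightarrow> left_lim x s) (at_left s)"
  shows "isCont x s \<longleftrightarrow> jump x s = 0"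
proof
  assume "isCont x s"
  hence "(x \<longlongrightarrow> x s) (at_left s)"
    by (auto simp: isCont_def intro: tendsto_within_subset)
  hence "left_lim x s = x s" unfolding left_lim_def by (intro tendsto_Lim) auto
  thus "jump x s = 0" by (simp add: jump_def)
next
  assume "jump x s = 0"
  thus "isCont x s" using assms
    by (auto simp: jump_def isCont_def continuous_within filterlim_split_at)
qed

lemma cadlag_left_lim:
  assumes "cadlag x" "s > 0" shows "(x \<longlongrightarrow> left_lim x s) (at_left s)"
proof -
  obtain l where l: "(x \<longlongrightarrow> l) (at_left s)" using assms by (auto simp: cadlag_def)
  hence "left_lim x s = l" unfolding left_lim_def by (intro tendsto_Lim) auto
  thus ?thesis using l by simp
qed

locale increasing_piece =
  fixes x :: "real \<Rightarrow> real" and a b :: real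
  assumes ab: "a < b" and mono_x: "mono_on {a..<b} x"
    and rc_x: "a \<le> s \<Longrightarrow> s < b \<Longrightarrow> continuous (at_right s) x"
    and left_x: "a < s \<Longrightarrow> s \<le> b \<Longrightarrow> (x \<longlongrightarrow> left_lim x s) (at_left s)"
begin

lemma x_mono: "a \<le> u \<Longrightarrow> u \<le> v \<Longrightarrow> v < b \<Longrightarrow> x u \<le> x v"
  using mono_x by (auto simp: monotone_on_def)

lemma x_le_left_lim:
  assumes "a \<le> u" "u < s" "s \<le> b" shows "x u \<le> left_lim x s"
proof (rule tendsto_lowerbound)
  show "(x \<longlongrightarrow> left_lim x s) (at_left s)" using assms left_x by auto
  show "\<forall>\<^sub>F v in at_left s. x u \<le> x v"
    using eventually_at_left_real[OF assms(2)] x_mono assms by (force elim!: eventually_mono)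
qed simp

lemma left_lim_le:
  assumes "a < s" "s \<le> b" "\<And>u. a \<le> u \<Longrightarrow> u < s \<Longrightarrow> x u \<le> c" shows "left_lim x s \<le> c"
proof (rule tendsto_upperbound)
  show "(x \<longlongrightarrow> left_lim x s) (at_left s)" using assms left_x by auto
  show "\<forall>\<^sub>F v in at_left s. x v \<le> c"
    using eventually_at_left_real[OF assms(1)] assms by (force elim!: eventually_mono)
qed simp

lemma jump_nonneg: "a < s \<Longrightarrow> s < b \<Longrightarrow> 0 \<le> jump x s"
  unfolding jump_def using left_lim_le[of s "x s"] x_mono by auto

text \<open>The path is frozen outside the piece, from \<open>b\<close> on at its left limit, which
  cuts off the jump there. The result is nondecreasing and right-continuous on the whole line with
  finite limits at both ends, as the pseudoinverse of \<open>right_continuous_mono\<close>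
  expects.\<close>

definition F :: "real \<Rightarrow> real" where
  "F s = (if s < a then x a else if s < b then x s else left_lim x b)"

lemma mono_F: "mono F"
proof (rule monoI)
  fix u v :: real assume "u \<le> v"
  thus "F u \<le> F v" using ab x_mono[of a v] x_mono[of u v] x_le_left_lim[of a b] x_le_left_lim[of u b]
    by (auto simp: F_def)
qed

sublocale right_continuous_mono F "x a" "left_lim x b"
proof
  show "mono F" by (rule mono_F)
  fix s
  show "continuous (at_right s) F"
  proof (cases "a \<le> s \<and> s < b")
    case True
    have "\<forall>\<^sub>F v in at_right s. x v = F v"
      using eventually_at_right_real[of s b] True by (auto simp: F_def elim!: eventually_mono)
    moreover have "(x \<longlongrightarrow> F s) (at_right s)"
      using rc_x[of s] True by (simp add: continuous_within F_def)
    ultimately show ?thesis unfolding continuous_within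
      by (rule Lim_transform_eventually[rotated])
  next
    case False
    have "\<forall>\<^sub>F v in at_right s. F s = F v"
    proof (cases "s < a")
      case True
      thus ?thesis using eventually_at_right_real[of s a] by (auto simp: F_def elim!: eventually_mono)
    next
      case False
      with \<open>\<not> (a \<le> s \<and> s < b)\<close> show ?thesis
        using eventually_at_right_less[of s] ab by (auto simp: F_def elim!: eventually_mono)
    qed
    thus ?thesis unfolding continuous_within by (rule Lim_transform_eventually[OF tendsto_const])
  qed
next
  have "\<forall>\<^sub>F s in at_bot. x a = F s"
    using eventually_gt_at_bot[of a] by (rule eventually_mono) (simp add: F_def)
  thus "(F \<longlongrightarrow> x a) at_bot" by (rule Lim_transform_eventually[OF tendsto_const])
  have "\<forall>\<^sub>F s in at_top. left_lim x b = F s"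
    using eventually_ge_at_top[of b] by (rule eventually_mono) (use ab in \<open>simp add: F_def\<close>)
  thus "(F \<longlongrightarrow> left_lim x b) at_top" by (rule Lim_transform_eventually[OF tendsto_const])
qed

definition W :: "real set" where "W = {x a<..<left_lim x b}"

text \<open>\<open>inv_x\<close> transports Lebesgue measure on \<open>W\<close> to \<open>dx\<close> on \<open>{a<..<b}\<close>; the values skipped by the jumps are
  sent to the jump times, all other values \<open>z\<close> to a time at which \<open>x\<close> takes the value \<open>z\<close>.\<close>

definition inv_x :: "real \<Rightarrow> real" where "inv_x z = Inf {s. z \<le> F s}"

lemma W_borel [measurable]: "W \<in> sets borel" by (simp add: W_def)

lemma inv_x_le_iff: "z \<in> W \<Longrightarrow> inv_x z \<le> s \<longleftrightarrow> z \<le> F s"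
  using pseudoinverse[of z s] by (simp add: W_def inv_x_def)

lemma inv_x_in:
  assumes "z \<in> W" shows "inv_x z \<in> {a<..<b}"
proof -
  have "\<not> inv_x z \<le> a" using inv_x_le_iff[OF assms] assms ab by (auto simp: F_def W_def)
  moreover have "inv_x z < b"
  proof -
    have "(x \<longlongrightarrow> left_lim x b) (at_left b)" using left_x ab by auto
    from order_tendstoD(1)[OF this, of z] have "\<forall>\<^sub>F s in at_left b. z < x s"
      using assms by (auto simp: W_def)
    moreover have "\<forall>\<^sub>F s in at_left b. s \<in> {a<..<b}" using ab by (rule eventually_at_left_real)
    ultimately have "\<forall>\<^sub>F s in at_left b. z < x s \<and> a < s \<and> s < b" by eventually_elim simp
    then obtain s where "z < x s" "a < s" "s < b"
      by (metis (mono_tags, lifting) eventually_happens' trivial_limit_at_left_real)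
    thus ?thesis using inv_x_le_iff[OF assms, of s] by (auto simp: F_def)
  qed
  ultimately show ?thesis by auto
qed

lemma inv_x_bounds:
  assumes "z \<in> W" shows "left_lim x (inv_x z) \<le> z" "z \<le> x (inv_x z)"
proof -
  note I = inv_x_in[OF assms]
  show "z \<le> x (inv_x z)" using inv_x_le_iff[OF assms, of "inv_x z"] I by (auto simp: F_def)
  have "x u \<le> z" if "a \<le> u" "u < inv_x z" for u
    using inv_x_le_iff[OF assms, of u] that I by (auto simp: F_def)
  thus "left_lim x (inv_x z) \<le> z" using I by (intro left_lim_le) auto
qed

lemma inv_x_eqI:
  assumes "z \<in> W" "a < s" "s < b" "z \<le> x s" "\<And>u. a \<le> u \<Longrightarrow> u < s \<Longrightarrow> x u < z"
  shows "inv_x z = s"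
proof (rule antisym)
  show "inv_x z \<le> s" using inv_x_le_iff[OF assms(1), of s] assms by (auto simp: F_def)
  show "s \<le> inv_x z"
    using inv_x_le_iff[OF assms(1), of "inv_x z"] inv_x_in[OF assms(1)] assms(5)[of "inv_x z"]
    by (force simp: F_def)
qed

lemma mono_inv_x: "mono_on W inv_x"
  using mono_I unfolding W_def inv_x_def .

lemma measurable_inv_x: "inv_x \<in> borel_measurable (restrict_space borel W)"
  by (intro borel_measurable_mono_on_fnc mono_inv_x)

lemma inv_x_vimage [measurable]:
  assumes "S \<in> sets borel" shows "W \<inter> inv_x -` S \<in> sets borel"
proof -
  have "inv_x -` S \<inter> space (restrict_space borel W) \<in> sets (restrict_space borel W)"
    using measurable_inv_x assms by (rule measurable_sets)
  thus ?thesis by (auto simp: sets_restrict_space_iff space_restrict_space Int_commute)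
qed

definition jumps :: "real set" where "jumps = {s \<in> {a<..<b}. jump x s \<noteq> 0}"

lemma countable_jumps: "countable jumps"
proof -
  have "mono_on {a<..<b} x" using mono_x by (rule monotone_on_subset) auto
  hence "countable {s\<in>{a<..<b}. \<not> isCont x s}" by (intro mono_on_ctble_discont_open) auto
  moreover have "jumps \<subseteq> {s\<in>{a<..<b}. \<not> isCont x s}"
    using rc_x left_x by (auto simp: jumps_def isCont_iff_jump_0)
  ultimately show ?thesis by (rule countable_subset[rotated])
qed

lemma borel_subset_jumps [measurable]: "S \<subseteq> jumps \<Longrightarrow> S \<in> sets borel"
  using countable_subset[OF _ countable_jumps] by (auto intro: sets.countable)

lemma x_inv_x: "z \<in> W \<Longrightarrow> inv_x z \<notin> jumps \<Longrightarrow> x (inv_x z) = z"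
  using inv_x_bounds[of z] inv_x_in[of z] by (auto simp: jumps_def jump_def)

text \<open>Up to its end points, the fibre of \<open>inv_x\<close> over \<open>s\<close> is the gap
  of levels skipped at \<open>s\<close>, and the integral of \<open>g\<close> over this gap is an
  increment of \<open>f\<close>. At a continuity time both sides are 0.\<close>

lemma integral_fibre:
  assumes "primitive f g" "a < s" "s < b"
  shows "(LINT z:W \<inter> inv_x -` {s}|lborel. g z) = f (x s) - f (left_lim x s)"
proof -
  interpret primitive f g by fact
  have le: "left_lim x s \<le> x s" using jump_nonneg assms by (simp add: jump_def)
  have 1: "x a \<le> left_lim x s" using assms by (intro x_le_left_lim) auto
  have 2: "x s \<le> left_lim x b" using assms by (intro x_le_left_lim) auto
  have 3: "inv_x z = s" if "left_lim x s < z" "z < x s" for z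
  proof (rule inv_x_eqI)
    show "x u < z" if "a \<le> u" "u < s" for u
      using x_le_left_lim[of u s] that assms \<open>left_lim x s < z\<close> by auto
  qed (use that 1 2 assms in \<open>auto simp: W_def\<close>)
  show ?thesis unfolding diff_eq[OF le]
  proof (rule set_integral_lborel_sandwich)
    show "{left_lim x s<..<x s} \<subseteq> W \<inter> inv_x -` {s}"
      using 1 2 3 by (auto simp: W_def)
    show "W \<inter> inv_x -` {s} \<subseteq> {left_lim x s..x s}"
      using inv_x_bounds by auto
  qed auto
qed

lemma has_sum_jumps:
  assumes "primitive f g" "B \<subseteq> {a<..<b}"
  shows "((\<lambda>s. f (x s) - f (left_lim x s)) has_sum
    (LINT z:W \<inter> inv_x -` (jumps \<inter> B)|lborel. g z)) B"
proof -
  interpret primitive f g by fact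
  have UN: "(\<Union>s\<in>jumps \<inter> B. W \<inter> inv_x -` {s}) = W \<inter> inv_x -` (jumps \<inter> B)" by auto
  have "((\<lambda>s. LINT z:W \<inter> inv_x -` {s}|lborel. g z) has_sum
    (LINT z:(\<Union>s\<in>jumps \<inter> B. W \<inter> inv_x -` {s})|lborel. g z)) (jumps \<inter> B)"
  proof (rule has_sum_set_integral_UN)
    show "countable (jumps \<inter> B)" using countable_jumps by simp
    have "W \<inter> inv_x -` (jumps \<inter> B) \<in> sets borel"
      by (intro inv_x_vimage borel_subset_jumps) auto
    thus "set_integrable lborel (\<Union>s\<in>jumps \<inter> B. W \<inter> inv_x -` {s}) g"
      unfolding UN by (rule integrable_subset_Icc[of _ "x a" "left_lim x b"]) (auto simp: W_def)
  qed (auto simp: disjoint_family_on_def)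
  also have "?this \<longleftrightarrow> ((\<lambda>s. f (x s) - f (left_lim x s)) has_sum
    (LINT z:(\<Union>s\<in>jumps \<inter> B. W \<inter> inv_x -` {s})|lborel. g z)) B"
    using assms integral_fibre[OF assms(1)]
    by (intro has_sum_cong_neutral) (auto simp: jumps_def jump_def)
  finally show ?thesis unfolding UN .
qed

text \<open>The set \<open>S\<close> selects the levels whose Lebesgue measure is transported:
  \<open>UNIV\<close> for \<open>dx\<close>, \<open>- jumps\<close> for the continuous part, and
  \<open>{}\<close> for a negative variation, which does not charge the open piece.\<close>

lemma emeasure_interval_measure_inv_x:
  assumes mono: "\<And>u v. u \<le> v \<Longrightarrow> G u \<le> G v" and rc: "\<And>s. continuous (at_right s) G"
    and S: "S \<in> sets borel"
    and eq: "\<And>u v. a \<le> u \<Longrightarrow> u \<le> v \<Longrightarrow> v < b \<Longrightarrow>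
      emeasure lborel (W \<inter> inv_x -` (S \<inter> {u<..v})) = ennreal (G v - G u)"
    and A: "A \<in> sets borel" "A \<subseteq> {a<..<b}"
  shows "emeasure (interval_measure G) A = emeasure lborel (W \<inter> inv_x -` (S \<inter> A))"
proof -
  define R where "R = restrict_space lborel (W \<inter> inv_x -` S)"
  have "mono_on (W \<inter> inv_x -` S) inv_x" using mono_inv_x by (rule monotone_on_subset) auto
  hence "inv_x \<in> borel_measurable (restrict_space borel (W \<inter> inv_x -` S))"
    by (rule borel_measurable_mono_on_fnc)
  moreover have "sets R = sets (restrict_space borel (W \<inter> inv_x -` S))"
    by (simp add: R_def sets_restrict_space)
  ultimately have I: "inv_x \<in> borel_measurable R" by (simp cong: measurable_cong_sets)
  have R: "emeasure (distr R borel inv_x) B = emeasure lborel (W \<inter> inv_x -` (S \<inter> B))"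
    if "B \<in> sets borel" for B
  proof -
    have "emeasure (distr R borel inv_x) B = emeasure R (inv_x -` B \<inter> space R)"
      using I that by (rule emeasure_distr)
    also have "\<dots> = emeasure lborel (W \<inter> inv_x -` (S \<inter> B))"
      unfolding R_def using S
      by (subst emeasure_restrict_space) (auto simp: space_restrict_space intro!: arg_cong[where f="emeasure lborel"])
    finally show ?thesis .
  qed
  have "emeasure (interval_measure G) A = emeasure (distr R borel inv_x) A"
    by (rule emeasure_interval_measure_eqI[OF mono rc ab]) (use A eq R in auto)
  thus ?thesis using R A by simp
qed

lemma emeasure_inv_x_Ioc:
  assumes "a \<le> u" "u \<le> v" "v < b"
  shows "emeasure lborel (W \<inter> inv_x -` {u<..v}) = ennreal (x v - x u)"
proof -
  have le: "x a \<le> x u" "x u \<le> x v" "x v \<le> left_lim x b"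
    using assms x_mono x_le_left_lim by auto
  have *: "W \<inter> inv_x -` {u<..v} = {z \<in> W. x u < z \<and> z \<le> x v}"
    using inv_x_le_iff assms by (auto simp: F_def not_le[symmetric])
  show ?thesis
  proof (rule antisym)
    show "emeasure lborel (W \<inter> inv_x -` {u<..v}) \<le> ennreal (x v - x u)"
      using emeasure_mono[of "W \<inter> inv_x -` {u<..v}" "{x u..x v}" lborel] * le by (auto simp: subset_eq)
    have "{x u<..<x v} \<subseteq> W \<inter> inv_x -` {u<..v}" unfolding * using le by (auto simp: W_def)
    from emeasure_mono[OF this, of lborel] show "ennreal (x v - x u) \<le> emeasure lborel (W \<inter> inv_x -` {u<..v})"
      using le by simp
  qed
qed

lemma emeasure_inv_x_Ioo:
  assumes "a \<le> u" "u < b"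
  shows "emeasure lborel (W \<inter> inv_x -` {u<..<b}) = ennreal (left_lim x b - x u)"
proof -
  have le: "x a \<le> x u" "x u \<le> left_lim x b"
    using assms x_mono x_le_left_lim by auto
  have "W \<inter> inv_x -` {u<..<b} = {x u<..<left_lim x b}"
    using inv_x_le_iff[of _ u] inv_x_in assms le by (auto simp: F_def W_def not_le[symmetric])
  thus ?thesis using le by simp
qed

lemma has_sum_jump:
  assumes "B \<subseteq> {a<..<b}"
  shows "(jump x has_sum measure lborel (W \<inter> inv_x -` (jumps \<inter> B))) B"
proof -
  have [measurable]: "W \<inter> inv_x -` (jumps \<inter> B) \<in> sets borel"
    by (intro inv_x_vimage borel_subset_jumps) auto
  have "(LINT z:W \<inter> inv_x -` (jumps \<inter> B)|lborel. 1) = measure lborel (W \<inter> inv_x -` (jumps \<inter> B))"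
    by (simp add: set_lebesgue_integral_def)
  moreover have "(\<lambda>s. x s - left_lim x s) = jump x" by (simp add: jump_def fun_eq_iff)
  ultimately show ?thesis using has_sum_jumps[OF primitive_id assms] by simp
qed

lemma emeasure_W_subset_finite: "emeasure lborel (W \<inter> S) \<noteq> \<infinity>"
proof -
  have "emeasure lborel (W \<inter> S) \<le> emeasure lborel {x a..left_lim x b}"
    by (intro emeasure_mono) (auto simp: W_def)
  also have "\<dots> < \<infinity>" by (simp add: emeasure_lborel_Icc_eq)
  finally show ?thesis by simp
qed

text \<open>The splitting of an increment into continuous part and jumps, seen on the side of the
  levels.\<close>

lemma measure_inv_x_split:
  assumes B: "B \<in> sets borel" "B \<subseteq> {a<..<b}"
  shows "measure lborel (W \<inter> inv_x -` B) =
    measure lborel (W \<inter> inv_x -` (- jumps \<inter> B)) + (\<Sum>\<^sub>\<infinity>s\<in>B. jump x s)"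
proof -
  have "jumps \<in> sets borel" by (rule borel_subset_jumps) simp
  hence sets: "W \<inter> inv_x -` (- jumps \<inter> B) \<in> sets lborel" "W \<inter> inv_x -` (jumps \<inter> B) \<in> sets lborel"
    using B by (auto intro!: inv_x_vimage simp del: vimage_Int)
  have "W \<inter> inv_x -` B = (W \<inter> inv_x -` (- jumps \<inter> B)) \<union> (W \<inter> inv_x -` (jumps \<inter> B))" by auto
  hence "measure lborel (W \<inter> inv_x -` B) =
    measure lborel (W \<inter> inv_x -` (- jumps \<inter> B)) + measure lborel (W \<inter> inv_x -` (jumps \<inter> B))"
    using measure_Union[OF emeasure_W_subset_finite emeasure_W_subset_finite sets] by auto
  thus ?thesis using infsumI[OF has_sum_jump[OF B(2)]] by simp
qed

end

section \<open>The continuous part on an increasing piece\<close>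

locale increasing_piece_cont = increasing_piece +
  fixes y :: "real \<Rightarrow> real"
  assumes y_diff: "a \<le> u \<Longrightarrow> u \<le> v \<Longrightarrow> v \<le> b \<Longrightarrow>
    y v - y u = x v - x u - (\<Sum>\<^sub>\<infinity>s\<in>{u<..v}. jump x s)"
begin

text \<open>Being lengths of sets of levels, the increments are nonnegative and dominated by those
  of \<open>x\<close>; monotonicity and continuity of \<open>y\<close> follow from this.\<close>

lemma y_diff_eq_measure:
  assumes "a \<le> u" "u \<le> v" "v \<le> b"
  shows "y v - y u = measure lborel (W \<inter> inv_x -` (- jumps \<inter> {u<..v}))"
proof (cases "v < b")
  case True
  have "measure lborel (W \<inter> inv_x -` {u<..v}) = x v - x u"
    using emeasure_inv_x_Ioc[OF assms(1,2) True] x_mono assms True by (simp add: measure_def)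
  thus ?thesis using measure_inv_x_split[of "{u<..v}"] assms True y_diff[of u v] by force
next
  case False
  show ?thesis
  proof (cases "u = b")
    case True thus ?thesis using False assms by simp
  next
    case 2: False
    have v: "v = b" and ub: "u < b" using False assms 2 by auto
    have "W \<inter> inv_x -` (- jumps \<inter> {u<..v}) = W \<inter> inv_x -` (- jumps \<inter> {u<..<b})"
      using inv_x_in v by force
    moreover have "measure lborel (W \<inter> inv_x -` {u<..<b}) = left_lim x b - x u"
      using emeasure_inv_x_Ioo[OF assms(1) ub] x_le_left_lim assms ub by (simp add: measure_def)
    \<comment> \<open>The jump at \<open>b\<close> occurs both in \<open>x b\<close> and in the sum.
      It cancels and leaves \<open>left_lim x b\<close>, in accordance with \<open>inv_x\<close>
      never taking the value \<open>b\<close>.\<close>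
    moreover have "(\<Sum>\<^sub>\<infinity>s\<in>{u<..v}. jump x s) = jump x b + (\<Sum>\<^sub>\<infinity>s\<in>{u<..<b}. jump x s)"
    proof -
      have "{u<..v} = insert b {u<..<b}" using v ub by auto
      moreover have "jump x summable_on {u<..<b}"
        using assms by (intro has_sum_imp_summable[OF has_sum_jump]) auto
      ultimately show ?thesis by (simp add: infsum_insert)
    qed
    moreover have "{u<..<b} \<subseteq> {a<..<b}" using assms by auto
    ultimately show ?thesis
      using measure_inv_x_split[of "{u<..<b}"] assms y_diff[of u v] v by (simp add: jump_def)
  qed
qed

lemma mono_y: "mono_on {a..b} y"
  using y_diff_eq_measure by (intro mono_onI) (smt (verit) atLeastAtMost_iff measure_nonneg)

lemma y_diff_le: 
  assumes "a \<le> u" "u \<le> v" "v < b" shows "y v - y u \<le> x v - x u"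
proof -
  have "0 \<le> (\<Sum>\<^sub>\<infinity>s\<in>{u<..v}. jump x s)" using assms jump_nonneg by (intro infsum_nonneg) auto
  thus ?thesis using y_diff[of u v] assms by simp
qed

lemma y_diff_le_end:
  assumes "a \<le> u" "u < b" shows "y b - y u \<le> left_lim x b - x u"
proof -
  have "emeasure lborel (W \<inter> inv_x -` (- jumps \<inter> {u<..b})) \<le> emeasure lborel (W \<inter> inv_x -` {u<..<b})"
    using inv_x_in by (intro emeasure_mono) (force, auto)
  hence "measure lborel (W \<inter> inv_x -` (- jumps \<inter> {u<..b})) \<le> left_lim x b - x u"
    using emeasure_inv_x_Ioo[OF assms] x_le_left_lim assms
    by (auto simp: measure_def intro!: enn2real_leI)
  thus ?thesis using y_diff_eq_measure[of u b] assms by simp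
qed

lemma y_right_continuous:
  assumes "a \<le> s" "s < b" shows "continuous (at_right s) y"
proof -
  have s: "\<forall>\<^sub>F v in at_right s. v \<in> {s<..<b}" using assms by (intro eventually_at_right_real)
  have "(y \<longlongrightarrow> y s) (at_right s)"
  proof (rule tendsto_sandwich)
    show "\<forall>\<^sub>F v in at_right s. y s \<le> y v"
      using s by eventually_elim (use assms mono_y in \<open>auto simp: monotone_on_def\<close>)
    show "\<forall>\<^sub>F v in at_right s. y v \<le> y s + (x v - x s)"
      using s 
    proof eventually_elim
      case (elim v)
      thus ?case using y_diff_le[of s v] assms by simp
    qed
    have "((\<lambda>v. y s + (x v - x s)) \<longlongrightarrow> y s + (x s - x s)) (at_right s)"
      using rc_x[OF assms] unfolding continuous_within by (intro tendsto_intros)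
    thus "((\<lambda>v. y s + (x v - x s)) \<longlongrightarrow> y s) (at_right s)" by simp
  qed simp
  thus ?thesis by (simp add: continuous_within)
qed

text \<open>The increments of \<open>y\<close> up to \<open>b\<close> are at most
  \<open>left_lim x b - x v\<close>, which tends to 0. Consequently \<open>dy\<close> has no atom at
  \<open>b\<close>, even if \<open>x\<close> jumps there.\<close>

lemma y_left_continuous_end: "(y \<longlongrightarrow> y b) (at_left b)"
proof -
  have s: "\<forall>\<^sub>F v in at_left b. v \<in> {a<..<b}" using ab by (intro eventually_at_left_real)
  show ?thesis
  proof (rule tendsto_sandwich)
    show "\<forall>\<^sub>F v in at_left b. y v \<le> y b"
      using s by eventually_elim (use mono_y in \<open>auto simp: monotone_on_def\<close>)
    show "\<forall>\<^sub>F v in at_left b. y b - (left_lim x b - x v) \<le> y v"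
      using s 
    proof eventually_elim
      case (elim v)
      thus ?case using y_diff_le_end[of v] by simp
    qed
    have "((\<lambda>v. y b - (left_lim x b - x v)) \<longlongrightarrow> y b - (left_lim x b - left_lim x b)) (at_left b)"
      using left_x ab by (intro tendsto_intros) auto
    thus "((\<lambda>v. y b - (left_lim x b - x v)) \<longlongrightarrow> y b) (at_left b)" by simp
  qed simp
qed

end

section \<open>Change of variables on one monotone piece\<close>

definition local_time_on :: "(real \<Rightarrow> real) \<Rightarrow> real \<Rightarrow> real \<Rightarrow> real \<Rightarrow> real" where
  "local_time_on x z a b =
     real (card (inc_times x z \<inter> {a<..b})) - real (card (dec_times x z \<inter> {a<..b}))"

text \<open>With \<open>y\<close> the continuous part of \<open>x\<close>, all integrals are compared with the integral against \<open>y\<close>, which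
  makes every clause additive in the interval. A jump at \<open>b\<close> belongs to \<open>{a<..b}\<close>.\<close>

definition change_of_variable_on ::
    "(real \<Rightarrow> real) \<Rightarrow> (real \<Rightarrow> real) \<Rightarrow> (real \<Rightarrow> real) \<Rightarrow> (real \<Rightarrow> real) \<Rightarrow> real \<Rightarrow> real \<Rightarrow> bool" where
  "change_of_variable_on x y f g a b \<longleftrightarrow>
     LS_integrable y {a<..b} (\<lambda>s. g (x s)) \<and>
     ((\<lambda>s. f (x s) - f (left_lim x s)) has_sum
        (f (x b) - f (x a) - LS_integral y {a<..b} (\<lambda>s. g (x s)))) {a<..b} \<and>
     (LS_integrable x {a<..b} (\<lambda>s. g (left_lim x s)) \<longrightarrow>
        ((\<lambda>s. g (left_lim x s) * jump x s) has_sum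
           (LS_integral x {a<..b} (\<lambda>s. g (left_lim x s)) - LS_integral y {a<..b} (\<lambda>s. g (x s)))) {a<..b}) \<and>
     (\<exists>X. countable X \<and>
        (\<forall>z. z \<notin> X \<longrightarrow> finite (inc_times x z \<inter> {a<..b}) \<and> finite (dec_times x z \<inter> {a<..b}))) \<and>
     has_bochner_integral lborel (\<lambda>z. local_time_on x z a b * g z) (LS_integral y {a<..b} (\<lambda>s. g (x s)))"

lemma set_integrable_singleton:
  fixes h :: "'a \<Rightarrow> real"
  assumes "{b} \<in> sets M" "emeasure M {b} \<noteq> \<infinity>"
  shows "set_integrable M {b} h"
proof -
  have "integrable M (indicator {b} :: 'a \<Rightarrow> real)"
    using assms by (simp add: integrable_indicator_iff less_top)
  hence "integrable M (\<lambda>s. indicator {b} s * h b)" by (rule integrable_mult_left)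
  moreover have "(\<lambda>s. indicator {b} s * h b) = (\<lambda>s. indicator {b} s * h s)"
    by (auto simp: fun_eq_iff indicator_def)
  ultimately show ?thesis by (simp only: set_integrable_def real_scaleR_def)
qed

lemma set_integral_singleton:
  fixes h :: "real \<Rightarrow> real"
  assumes "{b} \<in> sets M" "emeasure M {b} \<noteq> \<infinity>"
  shows "(LINT s:{b}|M. h s) = h b * measure M {b}"
  using set_integral_at_point[OF set_integrable_singleton[OF assms] assms] .

lemma
  fixes h :: "'a \<Rightarrow> real"
  assumes "A \<in> sets M" "emeasure M A = 0" "set_borel_measurable M A h"
  shows set_integrable_null: "set_integrable M A h"
    and set_integral_null: "(LINT s:A|M. h s) = 0"
proof -
  have "A \<in> null_sets M" using assms by auto
  from AE_not_in[OF this] have ae: "AE s in M. indicator A s *\<^sub>R h s = 0"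
    by eventually_elim simp
  have "integrable M (\<lambda>s. indicator A s *\<^sub>R h s) \<longleftrightarrow> integrable M (\<lambda>s. 0::real)"
    by (rule integrable_cong_AE) (use ae assms(3) in \<open>simp_all add: set_borel_measurable_def\<close>)
  thus "set_integrable M A h" by (simp add: set_integrable_def)
  show "(LINT s:A|M. h s) = 0" unfolding set_lebesgue_integral_def
    using integral_eq_zero_AE[OF ae] .
qed

locale increasing_bv_piece = increasing_piece_cont x a b y + X: bv_path x + Y: bv_path y
  for x a b y +
  assumes a_nonneg: "0 \<le> a"
begin

abbreviation "W_cont \<equiv> W \<inter> inv_x -` (- jumps)"

lemma jumps_borel: "jumps \<in> sets borel" by (rule borel_subset_jumps) simp

lemma W_cont_borel [measurable]: "W_cont \<in> sets borel"
  using jumps_borel by (intro inv_x_vimage) auto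

lemma mono_on_x: "a \<le> u \<Longrightarrow> v < b \<Longrightarrow> mono_on {u..v} x"
  using mono_x by (rule monotone_on_subset) auto

lemma mono_on_y: "a \<le> u \<Longrightarrow> v \<le> b \<Longrightarrow> mono_on {u..v} y"
  using mono_y by (rule monotone_on_subset) auto

section \<open>Stieltjes measures as images of Lebesgue measure\<close>

lemma emeasure_pos_var_x:
  assumes "A \<in> sets borel" "A \<subseteq> {a<..<b}"
  shows "emeasure (interval_measure (pos_var x)) A = emeasure lborel (W \<inter> inv_x -` A)"
proof -
  have "emeasure (interval_measure (pos_var x)) A = emeasure lborel (W \<inter> inv_x -` (UNIV \<inter> A))"
  proof (rule emeasure_interval_measure_inv_x[OF X.pos_var_mono X.pos_var_right_continuous _ _ assms])
    fix u v assume "a \<le> u" "u \<le> v" "v < b"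
    thus "emeasure lborel (W \<inter> inv_x -` (UNIV \<inter> {u<..v})) = ennreal (pos_var x v - pos_var x u)"
      using emeasure_inv_x_Ioc[of u v] X.pos_var_mono_on(1)[OF mono_on_x[of u v]] a_nonneg by simp
  qed auto
  thus ?thesis by simp
qed

lemma emeasure_neg_var_x:
  assumes "A \<in> sets borel" "A \<subseteq> {a<..<b}"
  shows "emeasure (interval_measure (neg_var x)) A = 0"
proof -
  have "emeasure (interval_measure (neg_var x)) A = emeasure lborel (W \<inter> inv_x -` ({} \<inter> A))"
  proof (rule emeasure_interval_measure_inv_x[OF X.neg_var_mono X.neg_var_right_continuous _ _ assms])
    fix u v assume "a \<le> u" "u \<le> v" "v < b"
    thus "emeasure lborel (W \<inter> inv_x -` ({} \<inter> {u<..v})) = ennreal (neg_var x v - neg_var x u)"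
      using X.pos_var_mono_on(2)[OF mono_on_x[of u v]] a_nonneg by simp
  qed auto
  thus ?thesis by simp
qed

lemma emeasure_pos_var_y:
  assumes "A \<in> sets borel" "A \<subseteq> {a<..<b}"
  shows "emeasure (interval_measure (pos_var y)) A = emeasure lborel (W_cont \<inter> inv_x -` A)"
proof -
  have "emeasure (interval_measure (pos_var y)) A = emeasure lborel (W \<inter> inv_x -` (- jumps \<inter> A))"
  proof (rule emeasure_interval_measure_inv_x[OF Y.pos_var_mono Y.pos_var_right_continuous _ _ assms])
    fix u v assume "a \<le> u" "u \<le> v" "v < b"
    thus "emeasure lborel (W \<inter> inv_x -` (- jumps \<inter> {u<..v})) = ennreal (pos_var y v - pos_var y u)"
      using y_diff_eq_measure[of u v] Y.pos_var_mono_on(1)[OF mono_on_y[of u v]] a_nonneg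
        emeasure_eq_ennreal_measure[OF emeasure_W_subset_finite[unfolded infinity_ennreal_def]] by simp
  qed (use jumps_borel in auto)
  thus ?thesis by (simp add: Int_assoc)
qed

lemma emeasure_neg_var_y: "emeasure (interval_measure (neg_var y)) {a<..b} = 0"
  using emeasure_interval_measure_Ioc[OF _ Y.neg_var_mono Y.neg_var_right_continuous, of a b] ab
    Y.pos_var_mono_on(2)[OF mono_on_y[of a b]] a_nonneg by simp

lemma emeasure_pos_var_y_end: "emeasure (interval_measure (pos_var y)) {b} = 0"
proof -
  have "\<forall>\<^sub>F v in at_left b. v \<in> {a<..<b}" using ab by (rule eventually_at_left_real)
  hence "\<forall>\<^sub>F v in at_left b. pos_var y b - (y b - y v) = pos_var y v"
  proof eventually_elim
    case (elim v)
    thus ?case using Y.pos_var_mono_on(1)[OF mono_on_y[of v b]] a_nonneg by simp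
  qed
  moreover have "((\<lambda>v. pos_var y b - (y b - y v)) \<longlongrightarrow> pos_var y b - (y b - y b)) (at_left b)"
    using y_left_continuous_end by (intro tendsto_intros)
  ultimately have "(pos_var y \<longlongrightarrow> pos_var y b) (at_left b)"
    by (auto elim: Lim_transform_eventually)
  from emeasure_interval_measure_singleton[OF Y.pos_var_mono Y.pos_var_right_continuous this]
  show ?thesis by simp
qed

text \<open>The jump at \<open>b\<close> may have either sign, so it may charge either variation.
  The left limits at \<open>b\<close> are known from the piece: the positive variation has grown by
  \<open>left_lim x b - x a\<close>, whence \<open>p\<close>, and the negative one not at
  all.\<close>

lemma var_x_end:
  shows "emeasure (interval_measure (pos_var x)) {b} \<noteq> \<infinity>"
    and "emeasure (interval_measure (neg_var x)) {b} \<noteq> \<infinity>"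
    and "measure (interval_measure (pos_var x)) {b} - measure (interval_measure (neg_var x)) {b} = jump x b"
proof -
  define p where "p = pos_var x a + (left_lim x b - x a)"
  have ev: "\<forall>\<^sub>F v in at_left b. v \<in> {a<..<b}" using ab by (rule eventually_at_left_real)
  have "\<forall>\<^sub>F v in at_left b. pos_var x a + (x v - x a) = pos_var x v"
    using ev
  proof eventually_elim
    case (elim v)
    thus ?case using X.pos_var_mono_on(1)[OF mono_on_x[of a v]] a_nonneg by simp
  qed
  moreover have "((\<lambda>v. pos_var x a + (x v - x a)) \<longlongrightarrow> p) (at_left b)"
    unfolding p_def using left_x ab by (intro tendsto_intros) auto
  ultimately have P: "(pos_var x \<longlongrightarrow> p) (at_left b)"
    by (rule Lim_transform_eventually[rotated])
  have "\<forall>\<^sub>F v in at_left b. neg_var x a = neg_var x v"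
    using ev
  proof eventually_elim
    case (elim v)
    thus ?case using X.pos_var_mono_on(2)[OF mono_on_x[of a v]] a_nonneg by simp
  qed
  hence N: "(neg_var x \<longlongrightarrow> neg_var x a) (at_left b)"
    by (rule Lim_transform_eventually[OF tendsto_const])
  have "p \<le> pos_var x b"
    using P by (rule tendsto_upperbound)
      (use ev X.pos_var_mono in \<open>auto elim!: eventually_mono\<close>)
  moreover have "neg_var x a \<le> neg_var x b" using X.neg_var_mono ab by simp
  moreover note * = emeasure_interval_measure_singleton[OF X.pos_var_mono X.pos_var_right_continuous P]
    emeasure_interval_measure_singleton[OF X.neg_var_mono X.neg_var_right_continuous N]
  ultimately show "measure (interval_measure (pos_var x)) {b} - measure (interval_measure (neg_var x)) {b} = jump x b"
    using X.pos_var_minus_neg_var[of a] X.pos_var_minus_neg_var[of b] a_nonneg ab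
    by (simp add: measure_def p_def jump_def)
  show "emeasure (interval_measure (pos_var x)) {b} \<noteq> \<infinity>" "emeasure (interval_measure (neg_var x)) {b} \<noteq> \<infinity>"
    using * by auto
qed

lemma Ioc_eq: "{a<..b} = {a<..<b} \<union> {b}"
  using ab by auto

text \<open>Inside the piece \<open>x\<close> agrees with the monotone, hence Borel, function
  \<open>F\<close>; the value at \<open>b\<close> contributes a single point.\<close>

lemma set_borel_measurable_comp_x:
  fixes g :: "real \<Rightarrow> real"
  assumes [measurable]: "g \<in> borel_measurable borel"
  shows "set_borel_measurable borel {a<..<b} (\<lambda>s. g (x s))"
    and "set_borel_measurable borel {a<..b} (\<lambda>s. g (x s))"
proof -
  have [measurable]: "F \<in> borel_measurable borel" by (intro borel_measurable_mono mono_F)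
  have "(\<lambda>s. indicator {a<..<b} s *\<^sub>R g (F s)) = (\<lambda>s. indicator {a<..<b} s *\<^sub>R g (x s))"
    by (auto simp: fun_eq_iff indicator_def F_def)
  moreover have "(\<lambda>s. indicator {a<..<b} s *\<^sub>R g (F s) + indicator {b} s *\<^sub>R g (x b)) = (\<lambda>s. indicator {a<..b} s *\<^sub>R g (x s))"
    using ab by (auto simp: fun_eq_iff indicator_def F_def)
  moreover have "(\<lambda>s. indicator {a<..<b} s *\<^sub>R g (F s)) \<in> borel_measurable borel"
    "(\<lambda>s. indicator {a<..<b} s *\<^sub>R g (F s) + indicator {b} s *\<^sub>R g (x b)) \<in> borel_measurable borel"
    by measurable
  ultimately show "set_borel_measurable borel {a<..<b} (\<lambda>s. g (x s))"
    "set_borel_measurable borel {a<..b} (\<lambda>s. g (x s))"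
    by (simp_all add: set_borel_measurable_def)
qed

context
  fixes f g :: "real \<Rightarrow> real"
  assumes fg: "primitive f g"
begin

interpretation primitive f g by (rule fg)

lemma integrable_W_subset: "S \<in> sets borel \<Longrightarrow> S \<subseteq> W \<Longrightarrow> set_integrable lborel S g"
  by (rule integrable_subset_Icc[of _ "x a" "left_lim x b"]) (auto simp: W_def)

text \<open>On the open piece \<open>dy\<close> is the image of Lebesgue measure on
  \<open>W_cont\<close>, where \<open>x (inv_x z) = z\<close>, so \<open>g (x s)\<close> turns into
  \<open>g z\<close> and its integrability into that of \<open>g\<close> on a bounded set. The point
  \<open>b\<close> carries no mass.\<close>

lemma cont_part_integral:
  shows "LS_integrable y {a<..b} (\<lambda>s. g (x s))"
    and "LS_integral y {a<..b} (\<lambda>s. g (x s)) = (LINT z:W_cont|lborel. g z)"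
proof -
  let ?P = "interval_measure (pos_var y)" and ?N = "interval_measure (neg_var y)"
  note meas = set_borel_measurable_comp_x[OF borel]
  have "inv_x \<in> borel_measurable (restrict_space borel W_cont)"
    using mono_inv_x by (intro borel_measurable_mono_on_fnc) (auto intro: monotone_on_subset)
  note transport = this _ emeasure_pos_var_y meas(1)
  have cong: "g (x (inv_x z)) = g z" if "z \<in> W_cont" for z
    using x_inv_x[of z] that by auto
  have "set_integrable ?P {a<..<b} (\<lambda>s. g (x s)) \<longleftrightarrow> set_integrable lborel W_cont (\<lambda>z. g (x (inv_x z)))"
    by (rule set_integrable_transport[OF _ _ _ transport]) (use inv_x_in in auto)
  also have "\<dots> \<longleftrightarrow> set_integrable lborel W_cont g"
    using cong by (intro set_integrable_cong) auto
  finally have 1: "set_integrable ?P {a<..<b} (\<lambda>s. g (x s))"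
    using integrable_W_subset by simp
  have "(LINT s:{a<..<b}|?P. g (x s)) = (LINT z:W_cont|lborel. g (x (inv_x z)))"
    by (rule set_integral_transport[OF _ _ _ transport]) (use inv_x_in in auto)
  also have "\<dots> = (LINT z:W_cont|lborel. g z)"
    using cong by (intro set_lebesgue_integral_cong) auto
  finally have 2: "(LINT s:{a<..<b}|?P. g (x s)) = (LINT z:W_cont|lborel. g z)" .
  have b: "{b} \<in> sets ?P" "emeasure ?P {b} \<noteq> \<infinity>" using emeasure_pos_var_y_end by auto
  have 3: "set_integrable ?P {a<..b} (\<lambda>s. g (x s))"
    unfolding Ioc_eq by (intro set_integrable_Un 1 set_integrable_singleton b) auto
  have "(LINT s:{a<..b}|?P. g (x s)) = (LINT s:{a<..<b}|?P. g (x s)) + (LINT s:{b}|?P. g (x s))"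
    unfolding Ioc_eq by (intro set_integral_Un 1 set_integrable_singleton b) auto
  also have "(LINT s:{b}|?P. g (x s)) = 0"
    unfolding set_integral_singleton[OF b] using emeasure_pos_var_y_end by (simp add: measure_def)
  finally have 4: "(LINT s:{a<..b}|?P. g (x s)) = (LINT z:W_cont|lborel. g z)" using 2 by simp
  have "set_borel_measurable ?N {a<..b} (\<lambda>s. g (x s))"
    using meas(2) by (simp add: set_borel_measurable_def cong: measurable_cong_sets)
  note null = set_integrable_null[OF _ emeasure_neg_var_y this] set_integral_null[OF _ emeasure_neg_var_y this]
  show "LS_integrable y {a<..b} (\<lambda>s. g (x s))" using 3 null by (simp add: LS_integrable_def)
  show "LS_integral y {a<..b} (\<lambda>s. g (x s)) = (LINT z:W_cont|lborel. g z)"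
    using 4 null by (simp add: LS_integral_def)
qed

text \<open>The integral of \<open>g\<close> over all of \<open>W\<close> is
  \<open>f (left_lim x b) - f (x a)\<close>. The levels outside \<open>W_cont\<close> are those sent
  to jump times and give the jump terms inside the piece; the term at \<open>b\<close> is added
  separately.\<close>

lemma has_sum_jump_terms:
  "((\<lambda>s. f (x s) - f (left_lim x s)) has_sum
     (f (x b) - f (x a) - (LINT z:W_cont|lborel. g z))) {a<..b}"
proof -
  have Wj: "W \<inter> inv_x -` jumps \<in> sets borel" using jumps_borel by simp
  have le: "x a \<le> left_lim x b" using x_le_left_lim ab by simp
  have "f (left_lim x b) - f (x a) = (LINT z:W|lborel. g z)"
    unfolding diff_eq[OF le] by (rule set_integral_lborel_sandwich[symmetric]) (auto simp: W_def)
  also have "W = W_cont \<union> (W \<inter> inv_x -` jumps)" by auto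
  also have "(LINT z:\<dots>|lborel. g z) = (LINT z:W_cont|lborel. g z) + (LINT z:W \<inter> inv_x -` jumps|lborel. g z)"
    using Wj by (intro set_integral_Un integrable_W_subset) auto
  finally have "(LINT z:W \<inter> inv_x -` jumps|lborel. g z) =
    f (left_lim x b) - f (x a) - (LINT z:W_cont|lborel. g z)" by simp
  moreover have "jumps \<inter> {a<..<b} = jumps" by (auto simp: jumps_def)
  ultimately have "((\<lambda>s. f (x s) - f (left_lim x s)) has_sum
    (f (left_lim x b) - f (x a) - (LINT z:W_cont|lborel. g z))) {a<..<b}"
    using has_sum_jumps[OF fg, of "{a<..<b}"] by simp
  hence "((\<lambda>s. f (x s) - f (left_lim x s)) has_sum
    ((f (x b) - f (left_lim x b)) + (f (left_lim x b) - f (x a) - (LINT z:W_cont|lborel. g z)))) (insert b {a<..<b})"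
    by (rule has_sum_insert[rotated]) simp
  moreover have "(f (x b) - f (left_lim x b)) + (f (left_lim x b) - f (x a) - (LINT z:W_cont|lborel. g z)) =
    f (x b) - f (x a) - (LINT z:W_cont|lborel. g z)" by simp
  ultimately show ?thesis by (simp only: Ioc_eq Un_insert_right Un_empty_right)
qed

text \<open>On the side of the levels, \<open>g (left_lim x (inv_x z))\<close> equals
  \<open>g z\<close> on \<open>W_cont\<close> and is constant on each fibre over a jump time, where
  it integrates to \<open>g (left_lim x s) * jump x s\<close>. The hypothesis makes it integrable
  over \<open>W\<close>.\<close>

lemma has_sum_left_terms:
  assumes "LS_integrable x {a<..b} (\<lambda>s. g (left_lim x s))"
  shows "((\<lambda>s. g (left_lim x s) * jump x s) has_sum
    (LS_integral x {a<..b} (\<lambda>s. g (left_lim x s)) - (LINT z:W_cont|lborel. g z))) {a<..b}"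
proof -
  let ?P = "interval_measure (pos_var x)" and ?N = "interval_measure (neg_var x)"
  define h where "h s = g (left_lim x s)" for s
  have int: "set_integrable ?P {a<..b} h" "set_integrable ?N {a<..b} h"
    using assms unfolding h_def LS_integrable_def by auto
  have sub: "set_integrable ?P {a<..<b} h" "set_integrable ?N {a<..<b} h"
    using int by (auto intro: set_integrable_subset)
  have P: "(LINT s:{a<..b}|?P. h s) = (LINT s:{a<..<b}|?P. h s) + h b * measure ?P {b}"
    unfolding Ioc_eq using set_integral_singleton[of b ?P h] var_x_end sub
    by (subst set_integral_Un) (auto intro!: set_integrable_singleton)
  have N: "(LINT s:{a<..b}|?N. h s) = (LINT s:{a<..<b}|?N. h s) + h b * measure ?N {b}"
    unfolding Ioc_eq using set_integral_singleton[of b ?N h] var_x_end sub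
    by (subst set_integral_Un) (auto intro!: set_integrable_singleton)
  \<comment> \<open>Measurability of \<open>h\<close> is read off from its integrability.\<close>
  have meas: "set_borel_measurable borel {a<..<b} h" "set_borel_measurable ?N {a<..<b} h"
    using sub[unfolded set_integrable_def, THEN borel_measurable_integrable]
    by (simp_all add: set_borel_measurable_def cong: measurable_cong_sets)
  have N0: "(LINT s:{a<..<b}|?N. h s) = 0"
    using emeasure_neg_var_x meas by (intro set_integral_null) auto
  note transport = W_borel measurable_inv_x _ emeasure_pos_var_x meas(1)
  have intW: "set_integrable lborel W (\<lambda>z. h (inv_x z))"
  proof -
    have "set_integrable ?P {a<..<b} h \<longleftrightarrow> set_integrable lborel W (\<lambda>z. h (inv_x z))"
      by (rule set_integrable_transport[OF _ _ transport]) (use inv_x_in in auto)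
    thus ?thesis using sub by simp
  qed
  have "(LINT s:{a<..<b}|?P. h s) = (LINT z:W|lborel. h (inv_x z))"
    by (rule set_integral_transport[OF _ _ transport]) (use inv_x_in in auto)
  moreover have W: "W = W_cont \<union> (W \<inter> inv_x -` jumps)" by auto
  have Wj: "W \<inter> inv_x -` jumps \<in> sets borel" using jumps_borel by simp
  have intWj: "set_integrable lborel (W \<inter> inv_x -` jumps) (\<lambda>z. h (inv_x z))"
    using Wj by (intro set_integrable_subset[OF intW]) auto
  moreover have "(LINT z:W|lborel. h (inv_x z)) = (LINT z:W_cont|lborel. h (inv_x z)) + (LINT z:W \<inter> inv_x -` jumps|lborel. h (inv_x z))"
    by (subst W, rule set_integral_Un) (auto intro: intWj set_integrable_subset[OF intW])
  moreover have "(LINT z:W_cont|lborel. h (inv_x z)) = (LINT z:W_cont|lborel. g z)"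
  proof (intro set_lebesgue_integral_cong allI impI)
    fix z assume "z \<in> W_cont"
    hence "z \<in> W" "inv_x z \<notin> jumps" by auto
    with x_inv_x[of z] inv_x_in[of z] show "h (inv_x z) = g z"
      by (auto simp: h_def jumps_def jump_def)
  qed simp
  ultimately have Peq: "(LINT s:{a<..<b}|?P. h s) = (LINT z:W_cont|lborel. g z) + (LINT z:W \<inter> inv_x -` jumps|lborel. h (inv_x z))"
    by simp
  have UN: "(\<Union>s\<in>jumps. W \<inter> inv_x -` {s}) = W \<inter> inv_x -` jumps" by auto
  have fibre: "(LINT z:W \<inter> inv_x -` {s}|lborel. h (inv_x z)) = h s * jump x s" if "a < s" "s < b" for s
  proof -
    have "(LINT z:W \<inter> inv_x -` {s}|lborel. h (inv_x z)) = (LINT z:W \<inter> inv_x -` {s}|lborel. h s * 1)"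
      by (rule set_lebesgue_integral_cong) auto
    also have "\<dots> = h s * jump x s"
      unfolding set_integral_mult_right using integral_fibre[OF primitive_id that] by (simp add: jump_def)
    finally show ?thesis .
  qed
  have "((\<lambda>s. LINT z:W \<inter> inv_x -` {s}|lborel. h (inv_x z)) has_sum
      (LINT z:(\<Union>s\<in>jumps. W \<inter> inv_x -` {s})|lborel. h (inv_x z))) jumps"
    by (rule has_sum_set_integral_UN)
      (use countable_jumps intWj UN in \<open>auto simp: disjoint_family_on_def\<close>)
  also have "?this \<longleftrightarrow> ((\<lambda>s. h s * jump x s) has_sum
      (LINT z:(\<Union>s\<in>jumps. W \<inter> inv_x -` {s})|lborel. h (inv_x z))) {a<..<b}"
    using fibre by (intro has_sum_cong_neutral) (auto simp: jumps_def)
  finally have "((\<lambda>s. h s * jump x s) has_sum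
      (h b * jump x b + (LINT z:W \<inter> inv_x -` jumps|lborel. h (inv_x z)))) (insert b {a<..<b})"
    unfolding UN by (intro has_sum_insert) auto
  moreover have "h b * jump x b + (LINT z:W \<inter> inv_x -` jumps|lborel. h (inv_x z)) =
      LS_integral x {a<..b} h - (LINT z:W_cont|lborel. g z)"
    unfolding LS_integral_def P N N0 Peq var_x_end(3)[symmetric] by (simp add: algebra_simps)
  ultimately show ?thesis unfolding h_def[symmetric] by (simp add: Ioc_eq)
qed

lemma local_time_sets:
  assumes z: "z \<notin> insert (x b) (x ` \<rat>)"
  shows "inc_times x z \<inter> {a<..b} = (if z \<in> W_cont then {inv_x z} else {})"
    and "dec_times x z \<inter> {a<..b} = {}"
proof -
  have inc: "z \<in> W_cont \<and> s = inv_x z" if s: "s \<in> inc_times x z \<inter> {a<..b}" for s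
  proof -
    have xs: "x s = z" "isCont x s" and ev: "\<forall>\<^sub>F u in nhds s. sgn (x s - x u) = sgn (s - u)"
      using s by (auto simp: inc_times_def)
    have "s \<noteq> b" using xs z by auto
    hence sab: "a < s" "s < b" using s by auto
    obtain e where e: "e > 0" "\<And>u. dist u s < e \<Longrightarrow> sgn (x s - x u) = sgn (s - u)"
      using ev by (auto simp: eventually_nhds_metric)
    have less: "x u < z" if "a \<le> u" "u < s" for u
    proof -
      \<comment> \<open>Close enough to \<open>s\<close> for the sign condition and not before
        \<open>u\<close>; monotonicity then passes the inequality from \<open>v\<close> to
        \<open>u\<close>.\<close>
      define v where "v = max u (s - e / 2)"
      have v: "u \<le> v" "v < s" "dist v s < e" using e that by (auto simp: v_def dist_real_def)
      have "sgn (x s - x v) = 1" using e(2)[OF v(3)] v by simp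
      hence "x v < z" using xs by (simp add: sgn_if split: if_splits)
      moreover have "x u \<le> x v" using x_mono that v sab by auto
      ultimately show ?thesis by simp
    qed
    have greater: "z < left_lim x b"
    proof -
      define v where "v = min ((s + b) / 2) (s + e / 2)"
      have v: "s < v" "v < b" "dist v s < e" using e sab by (auto simp: v_def dist_real_def min_def field_simps)
      have "sgn (x s - x v) = -1" using e(2)[OF v(3)] v by simp
      hence "z < x v" using xs by (simp add: sgn_if split: if_splits)
      thus ?thesis using x_le_left_lim[of v b] v sab by simp
    qed
    have zW: "z \<in> W" using less[of a] greater sab by (auto simp: W_def)
    have "inv_x z = s" by (rule inv_x_eqI[OF zW sab]) (use xs less in auto)
    moreover have "s \<notin> jumps"
      using xs(2) isCont_iff_jump_0[of s x] rc_x left_x sab by (auto simp: jumps_def)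
    ultimately show ?thesis using zW by auto
  qed
  have conv: "inv_x z \<in> inc_times x z" if "z \<in> W_cont"
  proof -
    define s where "s = inv_x z"
    have zW: "z \<in> W" and s: "s \<notin> jumps" and sab: "a < s" "s < b" and xs: "x s = z"
      using that inv_x_in[of z] x_inv_x[of z] by (auto simp: s_def)
    have less: "x u < z" if "a < u" "u < s" for u
      using inv_x_le_iff[OF zW, of u] that sab by (auto simp: F_def s_def)
    \<comment> \<open>If \<open>x u\<close> were \<open>z\<close>, then \<open>x\<close> would be
      constant on \<open>{s..u}\<close> and take the value \<open>z\<close> at a rational
      time.\<close>
    have greater: "z < x u" if "s < u" "u < b" for u
    proof -
      obtain q where q: "q \<in> \<rat>" "s < q" "q < u" using Rats_dense_in_real[OF \<open>s < u\<close>] by blast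
      have "x s \<le> x q" "x q \<le> x u" using x_mono sab q that by auto
      moreover have "x q \<noteq> z" using z q by auto
      ultimately show ?thesis using xs by auto
    qed
    have "\<forall>\<^sub>F u in nhds s. u \<in> {a<..<b}"
      using sab by (intro eventually_nhds_in_open) auto
    hence "\<forall>\<^sub>F u in nhds s. sgn (x s - x u) = sgn (s - u)"
    proof eventually_elim
      case (elim u)
      thus ?case using less[of u] greater[of u] xs by (cases u s rule: linorder_cases) auto
    qed
    moreover have "isCont x s"
      using isCont_iff_jump_0[of s x] rc_x left_x sab s by (auto simp: jumps_def)
    ultimately show ?thesis unfolding s_def[symmetric]
      using xs sab a_nonneg by (simp add: inc_times_def)
  qed
  show "inc_times x z \<inter> {a<..b} = (if z \<in> W_cont then {inv_x z} else {})"
  proof (cases "z \<in> W_cont")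
    case True
    thus ?thesis using inc conv inv_x_in[of z] by auto
  next
    case False
    hence "inc_times x z \<inter> {a<..b} = {}" using inc by blast
    thus ?thesis using False by (simp only: if_False)
  qed
  show "dec_times x z \<inter> {a<..b} = {}"
  proof (rule ccontr)
    assume "dec_times x z \<inter> {a<..b} \<noteq> {}"
    then obtain s where s: "s \<in> dec_times x z" "a < s" "s \<le> b" by auto
    have xs: "x s = z" and ev: "\<forall>\<^sub>F u in nhds s. sgn (x s - x u) = sgn (u - s)"
      using s by (auto simp: dec_times_def)
    obtain e where e: "e > 0" "\<And>u. dist u s < e \<Longrightarrow> sgn (x s - x u) = sgn (u - s)"
      using ev by (auto simp: eventually_nhds_metric)
    have "s < b" using xs z s by (cases "s = b") auto
    define v where "v = max ((a + s) / 2) (s - e / 2)"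
    have v: "a < v" "v < s" "dist v s < e" using e s by (auto simp: v_def dist_real_def max_def field_simps)
    have "sgn (x s - x v) = -1" using e(2)[OF v(3)] v by simp
    hence "x s < x v" by (simp add: sgn_if split: if_splits)
    thus False using x_mono[of v s] v \<open>s < b\<close> by simp
  qed
qed

lemma local_time_integral:
  "has_bochner_integral lborel (\<lambda>z. local_time_on x z a b * g z) (LINT z:W_cont|lborel. g z)"
proof -
  let ?X = "insert (x b) (x ` \<rat>)"
  have "has_bochner_integral lborel (\<lambda>z. indicator W_cont z * g z) (LINT z:W_cont|lborel. g z)"
    using integrable_W_subset[of W_cont]
    by (simp add: set_integrable_def set_lebesgue_integral_def has_bochner_integral_iff)
  thus ?thesis
    by (rule has_bochner_integral_lborel_countable_difference[of _ _ ?X])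
      (simp_all add: countable_rat local_time_sets local_time_on_def)
qed

theorem change_of_variable_on_increasing_piece: "change_of_variable_on x y f g a b"
proof -
  have "\<exists>X. countable X \<and>
    (\<forall>z. z \<notin> X \<longrightarrow> finite (inc_times x z \<inter> {a<..b}) \<and> finite (dec_times x z \<inter> {a<..b}))"
    by (rule exI[of _ "insert (x b) (x ` \<rat>)"]) (simp add: local_time_sets countable_rat)
  thus ?thesis unfolding change_of_variable_on_def
    using cont_part_integral has_sum_jump_terms has_sum_left_terms local_time_integral by simp
qed

end

end

section \<open>The continuous part of a piecewise monotonic path\<close>

lemma piecewise_monotonic_cadlag: "piecewise_monotonic x \<Longrightarrow> cadlag x"
  by (simp add: piecewise_monotonic_def)

lemma cadlag_uminus: "cadlag x \<Longrightarrow> cadlag (\<lambda>s. - x s)"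
  unfolding cadlag_def using tendsto_minus[of x] by (blast intro: continuous_minus)

lemma left_lim_uminus:
  assumes "cadlag x" "s > 0" shows "left_lim (\<lambda>s. - x s) s = - left_lim x s"
  unfolding left_lim_def[of "\<lambda>s. - x s"]
  using tendsto_minus[OF cadlag_left_lim[OF assms]] by (intro tendsto_Lim) auto

lemma jump_uminus: "cadlag x \<Longrightarrow> s > 0 \<Longrightarrow> jump (\<lambda>s. - x s) s = - jump x s"
  by (simp add: jump_def left_lim_uminus)

lemma cont_part_uminus:
  assumes "cadlag x" shows "cont_part (\<lambda>s. - x s) = (\<lambda>s. - cont_part x s)"
proof
  fix t
  have "(\<Sum>\<^sub>\<infinity>s\<in>{0<..t}. jump (\<lambda>s. - x s) s) = (\<Sum>\<^sub>\<infinity>s\<in>{0<..t}. - jump x s)"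
    using jump_uminus[OF assms] by (intro infsum_cong) auto
  thus "cont_part (\<lambda>s. - x s) t = - cont_part x t"
    by (simp add: cont_part_def infsum_uminus)
qed

lemma cadlag_increasing_piece:
  assumes "cadlag x" "0 \<le> a" "a < b" "mono_on {a..<b} x"
  shows "increasing_piece x a b"
  using assms cadlag_left_lim[OF assms(1)] by unfold_locales (auto simp: cadlag_def)

lemma monotone_piece_cases:
  assumes x: "cadlag x" "0 \<le> a" "a < b" "monotone_piece x a b"
    and incr: "\<And>x. cadlag x \<Longrightarrow> mono_on {a..<b} x \<Longrightarrow> R x"
    and uminus: "R (\<lambda>s. - x s) \<Longrightarrow> R x"
  shows "R x"
proof (cases "mono_on {a..<b} x")
  case True
  thus ?thesis using incr x(1) by blast
next
  case False
  hence "mono_on {a..<b} (\<lambda>s. - x s)"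
    using x(4) by (auto simp: monotone_piece_def monotone_on_def)
  thus ?thesis using incr[OF cadlag_uminus[OF x(1)]] uminus by blast
qed

text \<open>Needed for \<open>cont_part\<close> to mean what it should: the infinite sum in it
  defaults to 0 for a family that is not summable, and would then not be additive in the
  interval.\<close>

lemma jump_summable:
  assumes "piecewise_monotonic x" "0 \<le> a" "a < b"
  shows "jump x summable_on {a<..b}"
  using assms
proof (induction rule: piecewise_monotonic_induct)
  case (piece a b)
  note x = piecewise_monotonic_cadlag[OF assms(1)]
  show ?case
  proof (rule monotone_piece_cases[OF x piece])
    fix x assume "cadlag x" "mono_on {a..<b} x"
    then interpret increasing_piece x a b using piece by (intro cadlag_increasing_piece)
    have "jump x summable_on {a<..<b}" using has_sum_jump[of "{a<..<b}"] by (auto intro: has_sum_imp_summable)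
    hence "jump x summable_on (insert b {a<..<b})" by (simp add: summable_on_insert_iff)
    moreover have "insert b {a<..<b} = {a<..b}" using piece by auto
    ultimately show "jump x summable_on {a<..b}" by simp
  next
    assume "jump (\<lambda>s. - x s) summable_on {a<..b}"
    also have "?this \<longleftrightarrow> (\<lambda>s. - jump x s) summable_on {a<..b}"
      using jump_uminus[OF x] piece by (intro summable_on_cong) auto
    finally show "jump x summable_on {a<..b}" by (simp add: summable_on_uminus)
  qed
next
  case (join a b c)
  have "{a<..c} = {a<..b} \<union> {b<..c}" using join by auto
  thus ?case using join by (auto intro!: summable_on_Un_disjoint)
qed

lemma cont_part_diff:
  assumes x: "piecewise_monotonic x" and uv: "0 \<le> u" "u \<le> v"
  shows "cont_part x v - cont_part x u = x v - x u - (\<Sum>\<^sub>\<infinity>s\<in>{u<..v}. jump x s)"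
proof -
  have summable: "jump x summable_on {s<..t}" if "0 \<le> s" for s t
    using jump_summable[OF x that, of t] by (cases "s < t") auto
  have "{0<..v} = {0<..u} \<union> {u<..v}" using uv by auto
  moreover have "(\<Sum>\<^sub>\<infinity>s\<in>{0<..u} \<union> {u<..v}. jump x s) = (\<Sum>\<^sub>\<infinity>s\<in>{0<..u}. jump x s) + (\<Sum>\<^sub>\<infinity>s\<in>{u<..v}. jump x s)"
    using uv by (intro infsum_Un_disjoint summable) auto
  ultimately show ?thesis by (simp add: cont_part_def)
qed

lemma increasing_piece_cont_part:
  assumes "piecewise_monotonic x" "0 \<le> a" "a < b" "mono_on {a..<b} x"
  shows "increasing_piece_cont x a b (cont_part x)"
proof -
  interpret increasing_piece x a b
    using assms by (intro cadlag_increasing_piece piecewise_monotonic_cadlag)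
  show ?thesis using assms by unfold_locales (auto intro: cont_part_diff)
qed

lemma piecewise_monotonic_uminus:
  assumes "piecewise_monotonic x" shows "piecewise_monotonic (\<lambda>s. - x s)"
proof -
  have "mono_on I (\<lambda>s. - x s) \<longleftrightarrow> antimono_on I x" "antimono_on I (\<lambda>s. - x s) \<longleftrightarrow> mono_on I x" for I
    by (auto simp: monotone_on_def)
  thus ?thesis using assms cadlag_uminus[of x] unfolding piecewise_monotonic_def
    by (simp add: disj_commute)
qed

text \<open>The closed interval is correct here although \<open>x\<close> is monotone only on
  \<open>{a..<b}\<close>, because the jump at \<open>b\<close> has been subtracted.\<close>

lemma monotone_piece_cont_part:
  assumes x: "piecewise_monotonic x" and ab: "0 \<le> a" "a < b" "monotone_piece x a b"
  shows "(mono_on {a..b} (cont_part x) \<or> antimono_on {a..b} (cont_part x)) \<and>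
    continuous (at_right a) (cont_part x)"
proof -
  have incr: "mono_on {a..b} (cont_part x) \<and> continuous (at_right a) (cont_part x)"
    if "piecewise_monotonic x" "mono_on {a..<b} x" for x
  proof -
    interpret increasing_piece_cont x a b "cont_part x"
      using that ab by (intro increasing_piece_cont_part)
    show ?thesis using mono_y y_right_continuous ab by auto
  qed
  show ?thesis
  proof (cases "mono_on {a..<b} x")
    case False
    hence "mono_on {a..<b} (\<lambda>s. - x s)"
      using ab by (auto simp: monotone_piece_def monotone_on_def)
    from incr[OF piecewise_monotonic_uminus[OF x] this]
    have 1: "mono_on {a..b} (\<lambda>s. - cont_part x s)" and 2: "continuous (at_right a) (\<lambda>s. - cont_part x s)"
      unfolding cont_part_uminus[OF piecewise_monotonic_cadlag[OF x]] by auto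
    have "continuous (at_right a) (cont_part x)" using continuous_minus[OF 2] by simp
    thus ?thesis using 1 by (auto simp: monotone_on_def)
  qed (use incr[OF x] in auto)
qed

section \<open>Finite variation of the path and of its continuous part\<close>

lemma variation_majorant_monotone:
  assumes "mono_on {a..b} x \<or> antimono_on {a..b} x"
  shows "\<exists>G. variation_majorant G x a b"
proof -
  have "variation_majorant x x a b \<or> variation_majorant (\<lambda>s. - x s) x a b"
    using assms by (auto simp: variation_majorant_def monotone_on_def)
  thus ?thesis by blast
qed

lemma variation_majorant_monotone_piece:
  assumes x: "cadlag x" "0 \<le> a" "a < b" "monotone_piece x a b"
  shows "\<exists>G. variation_majorant G x a b"
proof (rule monotone_piece_cases[OF x])
  fix x assume "cadlag x" "mono_on {a..<b} x"
  then interpret increasing_piece x a b using x by (intro cadlag_increasing_piece)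
  \<comment> \<open>The variation up to \<open>b\<close> is that of the monotone stretch plus the
    size of the last jump, whatever its sign.\<close>
  let ?G = "\<lambda>s. if s < b then x s else left_lim x b + \<bar>x b - left_lim x b\<bar>"
  have "variation_majorant ?G x a b" unfolding variation_majorant_def
  proof (intro allI impI)
    fix u v assume uv: "a \<le> u" "u \<le> v" "v \<le> b"
    consider "v < b" | "u < b" "v = b" | "u = v" using uv by linarith
    thus "\<bar>x v - x u\<bar> \<le> ?G v - ?G u"
      using x_mono[of u v] x_le_left_lim[of u b] uv by cases auto
  qed
  thus "\<exists>G. variation_majorant G x a b" by blast
qed (auto simp: variation_majorant_def abs_minus_commute)

text \<open>Serves both \<open>x\<close> and its continuous part: the pieces are always those of
  \<open>x\<close>, the properties to be checked on them those of \<open>y\<close>.\<close>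

lemma bv_pathI:
  assumes x: "piecewise_monotonic x"
    and rc: "\<And>u. 0 \<le> u \<Longrightarrow> continuous (at_right u) y"
    and piece: "\<And>a b. 0 \<le> a \<Longrightarrow> a < b \<Longrightarrow> monotone_piece x a b \<Longrightarrow>
      monotone_piece y a b \<and> (\<exists>G. variation_majorant G y a b)"
  shows "bv_path y"
proof
  fix T :: real assume "0 \<le> T"
  show "\<exists>G. variation_majorant G y 0 T"
  proof (cases "T = 0")
    case True
    thus ?thesis using variation_majorant_monotone[of 0 0 y] by (simp add: monotone_on_def)
  next
    case False
    hence "0 < T" using \<open>0 \<le> T\<close> by simp
    with x order_refl show ?thesis
    proof (induction rule: piecewise_monotonic_induct)
      case (join a b c)
      thus ?case using variation_majorant_join[of _ y a b _ c] by (meson less_imp_le)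
    qed (use piece in blast)
  qed
next
  fix u :: real assume u: "0 \<le> u"
  then obtain d where "d > 0" "monotone_piece x u (u + d)"
    using piecewise_monotonic_right_piece[OF x] by blast
  thus "\<exists>d>0. monotone_piece y u (u + d)" using piece[of u "u + d"] u by auto
qed (rule rc)

lemma bv_path_piecewise_monotonic:
  assumes "piecewise_monotonic x" shows "bv_path x"
  by (rule bv_pathI[OF assms])
    (use piecewise_monotonic_cadlag[OF assms] in
      \<open>auto simp: cadlag_def[of x] intro: variation_majorant_monotone_piece\<close>)

lemma bv_path_cont_part:
  assumes x: "piecewise_monotonic x" shows "bv_path (cont_part x)"
  using x
proof (rule bv_pathI)
  fix u :: real assume u: "0 \<le> u"
  then obtain d where "d > 0" "monotone_piece x u (u + d)"
    using piecewise_monotonic_right_piece[OF x] by blast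
  thus "continuous (at_right u) (cont_part x)"
    using monotone_piece_cont_part[OF x u, of "u + d"] by simp
next
  fix a b :: real assume "0 \<le> a" "a < b" "monotone_piece x a b"
  from monotone_piece_cont_part[OF x this]
  have *: "mono_on {a..b} (cont_part x) \<or> antimono_on {a..b} (cont_part x)" by simp
  hence "monotone_piece (cont_part x) a b"
    by (auto simp: monotone_piece_def monotone_on_def)
  thus "monotone_piece (cont_part x) a b \<and> (\<exists>G. variation_majorant G (cont_part x) a b)"
    using variation_majorant_monotone[OF *] by simp
qed

section \<open>Change of variables along the whole path\<close>

lemma LS_integrable_uminus:
  "LS_integrable (\<lambda>s. - y s) A (\<lambda>s. - h s) \<longleftrightarrow> LS_integrable y A h"
  by (auto simp: LS_integrable_def pos_var_uminus neg_var_uminus set_integrable_def)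

lemma LS_integral_uminus:
  "LS_integral (\<lambda>s. - y s) A (\<lambda>s. - h s) = LS_integral y A h"
  by (simp add: LS_integral_def pos_var_uminus neg_var_uminus set_lebesgue_integral_def)

lemma LS_integrable_cong:
  assumes "\<And>s. s \<in> A \<Longrightarrow> h s = h' s"
  shows "LS_integrable y A h \<longleftrightarrow> LS_integrable y A h'"
  unfolding LS_integrable_def using assms by (simp cong: set_integrable_cong)

lemma LS_integral_cong:
  assumes "A \<in> sets borel" "\<And>s. s \<in> A \<Longrightarrow> h s = h' s"
  shows "LS_integral y A h = LS_integral y A h'"
  unfolding LS_integral_def using assms
  by (intro arg_cong2[where f = "(-)"] set_lebesgue_integral_cong) auto

lemma LS_integrable_subset:
  "LS_integrable y A h \<Longrightarrow> B \<in> sets borel \<Longrightarrow> B \<subseteq> A \<Longrightarrow> LS_integrable y B h"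
  unfolding LS_integrable_def by (auto intro: set_integrable_subset)

lemma LS_integrable_Un:
  "LS_integrable y A h \<Longrightarrow> LS_integrable y B h \<Longrightarrow> A \<in> sets borel \<Longrightarrow> B \<in> sets borel \<Longrightarrow>
    LS_integrable y (A \<union> B) h"
  unfolding LS_integrable_def by (auto intro!: set_integrable_Un)

lemma LS_integral_Un:
  "LS_integrable y A h \<Longrightarrow> LS_integrable y B h \<Longrightarrow> A \<inter> B = {} \<Longrightarrow>
    LS_integral y (A \<union> B) h = LS_integral y A h + LS_integral y B h"
  unfolding LS_integrable_def LS_integral_def by (simp add: set_integral_Un)

lemma primitive_reflect:
  assumes "primitive f g" shows "primitive (\<lambda>z. f (- z)) (\<lambda>z. - g (- z))"
proof -
  interpret primitive f g by fact
  have ind: "indicator {u..v} (- z) = (indicator {- v..- u} z :: real)" for u v z :: real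
    by (auto simp: indicator_def)
  show ?thesis
  proof
    fix u v :: real
    have "integrable lborel (\<lambda>z. indicator {- v..- u} (0 + - 1 * z) *\<^sub>R g (0 + - 1 * z))"
      by (rule lborel_integrable_real_affine)
        (use integrable_Icc in \<open>auto simp: set_integrable_def\<close>)
    thus "set_integrable lborel {u..v} (\<lambda>z. - g (- z))"
      by (simp add: set_integrable_def ind)
    show "f (- v) - f (- u) = (LINT z:{u..v}|lborel. - g (- z))" if "u \<le> v"
    proof -
      have "(LINT z|lborel. indicator {- v..- u} z *\<^sub>R g z) =
        (LINT z|lborel. indicator {u..v} z *\<^sub>R g (- z))"
        by (subst lborel_integral_real_affine[where c = "- 1" and t = 0]) (auto simp: ind)
      hence "(LINT z:{u..v}|lborel. - g (- z)) = - (LINT z:{- v..- u}|lborel. g z)"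
        by (simp add: set_lebesgue_integral_def)
      thus ?thesis using diff_eq[of "- v" "- u"] that by simp
    qed
  qed (use borel in measurable)
qed

lemma inc_times_uminus: "inc_times (\<lambda>s. - x s) z = dec_times x (- z)"
  and dec_times_uminus: "dec_times (\<lambda>s. - x s) z = inc_times x (- z)"
proof -
  have 1: "isCont (\<lambda>s. - x s) t \<longleftrightarrow> isCont x t" for t
    using continuous_minus[of "at t" x] continuous_minus[of "at t" "\<lambda>s. - x s"] by auto
  have 2: "- x t = z \<longleftrightarrow> x t = - z" for t by auto
  have 3: "sgn (- x t - - x s) = sgn (t - s) \<longleftrightarrow> sgn (x t - x s) = sgn (s - t)"
    "sgn (- x t - - x s) = sgn (s - t) \<longleftrightarrow> sgn (x t - x s) = sgn (t - s)" for s t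
    by (auto simp: sgn_if)
  show "inc_times (\<lambda>s. - x s) z = dec_times x (- z)" "dec_times (\<lambda>s. - x s) z = inc_times x (- z)"
    unfolding inc_times_def dec_times_def 1 2 3 by simp_all
qed

text \<open>Path and levels are reflected together. The two variations are exchanged, jumps and
  local time change sign, and each of these signs is absorbed by the one in
  \<open>- g (- z)\<close>.\<close>

lemma change_of_variable_on_uminus:
  assumes x: "cadlag x" and a: "0 \<le> a"
    and cov: "change_of_variable_on (\<lambda>s. - x s) (\<lambda>s. - y s) (\<lambda>z. f (- z)) (\<lambda>z. - g (- z)) a b"
  shows "change_of_variable_on x y f g a b"
proof -
  have left: "left_lim (\<lambda>s. - x s) s = - left_lim x s" "jump (\<lambda>s. - x s) s = - jump x s"
    if "s \<in> {a<..b}" for s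
    using left_lim_uminus[OF x, of s] jump_uminus[OF x, of s] that a by auto
  have L: "LS_integrable x {a<..b} (\<lambda>s. g (- left_lim (\<lambda>s. - x s) s)) \<longleftrightarrow>
    LS_integrable x {a<..b} (\<lambda>s. g (left_lim x s))"
    "LS_integral x {a<..b} (\<lambda>s. g (- left_lim (\<lambda>s. - x s) s)) =
    LS_integral x {a<..b} (\<lambda>s. g (left_lim x s))"
    using left by (intro LS_integrable_cong LS_integral_cong; simp)+
  have lt: "local_time_on (\<lambda>s. - x s) z a b = - local_time_on x (- z) a b" for z
    by (simp add: local_time_on_def inc_times_uminus dec_times_uminus)
  have "has_bochner_integral lborel (\<lambda>z. local_time_on x (- z) a b * g (- z)) (LS_integral y {a<..b} (\<lambda>s. g (x s)))"
    using cov by (simp add: change_of_variable_on_def lt LS_integral_uminus)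
  hence bochner: "has_bochner_integral lborel (\<lambda>z. local_time_on x z a b * g z) (LS_integral y {a<..b} (\<lambda>s. g (x s)))"
    by (subst lborel_has_bochner_integral_real_affine_iff[where c = "- 1" and t = 0]) simp_all
  obtain X where X: "countable X" and
    fin_X: "\<And>z. z \<notin> X \<Longrightarrow> finite (dec_times x (- z) \<inter> {a<..b}) \<and> finite (inc_times x (- z) \<inter> {a<..b})"
    using cov by (auto simp: change_of_variable_on_def inc_times_uminus dec_times_uminus)
  have fin: "\<exists>X. countable X \<and> (\<forall>z. z \<notin> X \<longrightarrow>
    finite (inc_times x z \<inter> {a<..b}) \<and> finite (dec_times x z \<inter> {a<..b}))"
  proof (intro exI[of _ "uminus ` X"] conjI allI impI)
    fix z assume "z \<notin> uminus ` X"
    hence "- z \<notin> X" by (metis imageI minus_minus)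
    from fin_X[OF this] show "finite (inc_times x z \<inter> {a<..b})" "finite (dec_times x z \<inter> {a<..b})"
      by simp_all
  qed (use X in simp)
  have sum1: "((\<lambda>s. f (- (- x s)) - f (- left_lim (\<lambda>s. - x s) s)) has_sum S) {a<..b} \<longleftrightarrow>
    ((\<lambda>s. f (x s) - f (left_lim x s)) has_sum S) {a<..b}" for S
    by (intro has_sum_cong) (simp add: left)
  have sum2: "((\<lambda>s. - g (- left_lim (\<lambda>s. - x s) s) * jump (\<lambda>s. - x s) s) has_sum S) {a<..b} \<longleftrightarrow>
    ((\<lambda>s. g (left_lim x s) * jump x s) has_sum S) {a<..b}" for S
    by (intro has_sum_cong) (simp add: left)
  show ?thesis
    using cov unfolding change_of_variable_on_def sum1 sum2 LS_integrable_uminus LS_integral_uminus L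
    using bochner fin by simp
qed

text \<open>The conditional clause is additive because integrability on \<open>{a<..c}\<close>
  passes to both halves. Cardinalities add up only for finite sets, hence the union of the two
  exceptional sets.\<close>

lemma change_of_variable_on_join:
  assumes abc: "a < b" "b < c"
    and 1: "change_of_variable_on x y f g a b" and 2: "change_of_variable_on x y f g b c"
    and g: "g \<in> borel_measurable borel"
  shows "change_of_variable_on x y f g a c"
proof -
  have ac: "{a<..c} = {a<..b} \<union> {b<..c}" and disj: "{a<..b} \<inter> {b<..c} = {}" using abc by auto
  note Q1 = 1[unfolded change_of_variable_on_def] and Q2 = 2[unfolded change_of_variable_on_def]
  let ?L = "\<lambda>u v. LS_integral y {u<..v} (\<lambda>s. g (x s))"
  have int: "LS_integrable y {a<..c} (\<lambda>s. g (x s))"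
    unfolding ac using Q1 Q2 by (intro LS_integrable_Un) auto
  have L: "?L a c = ?L a b + ?L b c"
    unfolding ac using Q1 Q2 disj by (intro LS_integral_Un) auto
  have sum1: "((\<lambda>s. f (x s) - f (left_lim x s)) has_sum (f (x c) - f (x a) - ?L a c)) {a<..c}"
  proof -
    have "((\<lambda>s. f (x s) - f (left_lim x s)) has_sum
      ((f (x b) - f (x a) - ?L a b) + (f (x c) - f (x b) - ?L b c))) ({a<..b} \<union> {b<..c})"
      using Q1 Q2 disj by (intro has_sum_Un_disjoint) auto
    thus ?thesis unfolding L ac[symmetric] by (simp add: algebra_simps)
  qed
  have sum2: "((\<lambda>s. g (left_lim x s) * jump x s) has_sum
    (LS_integral x {a<..c} (\<lambda>s. g (left_lim x s)) - ?L a c)) {a<..c}"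
    if "LS_integrable x {a<..c} (\<lambda>s. g (left_lim x s))"
  proof -
    have sub: "LS_integrable x {a<..b} (\<lambda>s. g (left_lim x s))" "LS_integrable x {b<..c} (\<lambda>s. g (left_lim x s))"
      using abc by (auto intro!: LS_integrable_subset[OF that])
    let ?X = "\<lambda>u v. LS_integral x {u<..v} (\<lambda>s. g (left_lim x s))"
    have X: "?X a c = ?X a b + ?X b c"
      unfolding ac using sub disj by (rule LS_integral_Un)
    have "((\<lambda>s. g (left_lim x s) * jump x s) has_sum
      ((?X a b - ?L a b) + (?X b c - ?L b c))) ({a<..b} \<union> {b<..c})"
      using Q1 Q2 disj sub by (intro has_sum_Un_disjoint) auto
    thus ?thesis unfolding L X ac[symmetric] by (simp add: algebra_simps)
  qed
  obtain X1 X2 where X: "countable X1" "countable X2"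
    and X1: "\<And>z. z \<notin> X1 \<Longrightarrow> finite (inc_times x z \<inter> {a<..b}) \<and> finite (dec_times x z \<inter> {a<..b})"
    and X2: "\<And>z. z \<notin> X2 \<Longrightarrow> finite (inc_times x z \<inter> {b<..c}) \<and> finite (dec_times x z \<inter> {b<..c})"
    using Q1 Q2 by blast
  let ?X = "X1 \<union> X2"
  have cX: "countable ?X" using X by simp
  have fin: "finite (inc_times x z \<inter> {a<..c}) \<and> finite (dec_times x z \<inter> {a<..c})" if "z \<notin> ?X" for z
    using X1[of z] X2[of z] that unfolding ac by (auto simp: Int_Un_distrib)
  have card: "card (S \<inter> {a<..c}) = card (S \<inter> {a<..b}) + card (S \<inter> {b<..c})"
    if "finite (S \<inter> {a<..b})" "finite (S \<inter> {b<..c})" for S :: "real set"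
    unfolding ac Int_Un_distrib using that disj by (intro card_Un_disjoint) auto
  have lt: "local_time_on x z a c = local_time_on x z a b + local_time_on x z b c" if "z \<notin> ?X" for z
    using X1[of z] X2[of z] that unfolding local_time_on_def by (simp add: card)
  have sum_int: "has_bochner_integral lborel
    (\<lambda>z. local_time_on x z a b * g z + local_time_on x z b c * g z) (?L a c)"
    unfolding L using Q1 Q2 by (intro has_bochner_integral_add) auto
  have eq: "local_time_on x z a b * g z + local_time_on x z b c * g z = local_time_on x z a c * g z"
    if "z \<notin> ?X" for z using lt[OF that] by (simp add: distrib_right)
  from has_bochner_integral_lborel_countable_difference[OF sum_int cX eq]
  have "has_bochner_integral lborel (\<lambda>z. local_time_on x z a c * g z) (?L a c)" .
  thus ?thesis unfolding change_of_variable_on_def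
    using int sum1 sum2 cX fin by blast
qed

theorem piecewise_monotonic_change_of_variable:
  assumes x: "piecewise_monotonic x" and fg: "primitive f g" and ab: "0 \<le> a" "a < b"
  shows "change_of_variable_on x (cont_part x) f g a b"
  using x ab
proof (induction rule: piecewise_monotonic_induct)
  case (piece a b)
  have incr: "change_of_variable_on x (cont_part x) f g a b"
    if x: "piecewise_monotonic x" and "mono_on {a..<b} x" and fg: "primitive f g" for x f g
  proof -
    interpret increasing_piece_cont x a b "cont_part x"
      using that piece by (intro increasing_piece_cont_part)
    interpret X: bv_path x using x by (rule bv_path_piecewise_monotonic)
    interpret Y: bv_path "cont_part x" using x by (rule bv_path_cont_part)
    interpret increasing_bv_piece x a b "cont_part x"
      using piece by unfold_locales
    show ?thesis by (rule change_of_variable_on_increasing_piece[OF fg])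
  qed
  show ?case
  proof (cases "mono_on {a..<b} x")
    case False
    hence "mono_on {a..<b} (\<lambda>s. - x s)"
      using piece by (auto simp: monotone_piece_def monotone_on_def)
    from incr[OF piecewise_monotonic_uminus[OF x] this primitive_reflect[OF fg]]
    show ?thesis
      using change_of_variable_on_uminus[OF piecewise_monotonic_cadlag[OF x] piece(1)]
      by (simp add: cont_part_uminus[OF piecewise_monotonic_cadlag[OF x]])
  qed (use incr x fg in blast)
next
  case (join a b c)
  thus ?case using change_of_variable_on_join primitive.borel[OF fg] by blast
qed

lemma primitiveI:
  fixes f g :: "real \<Rightarrow> real"
  assumes g: "g \<in> borel_measurable borel"
    and int: "\<And>K. compact K \<Longrightarrow> set_integrable lborel K g"
    and f: "\<And>y. f y = (if y \<ge> 0 then f0 + (LINT z:{0..y}|lborel. g z)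
                        else f0 - (LINT z:{y..0}|lborel. g z))"
  shows "primitive f g"
proof
  show Icc: "set_integrable lborel {u..v} g" for u v by (rule int) simp
  have add: "(LINT z:{u..v}|lborel. g z) = (LINT z:{u..w}|lborel. g z) + (LINT z:{w..v}|lborel. g z)"
    if "u \<le> w" "w \<le> v" for u v w
  proof -
    have "{u..v} = {u..w} \<union> {w<..v}" "{u..w} \<inter> {w<..v} = {}" using that by auto
    hence "(LINT z:{u..v}|lborel. g z) = (LINT z:{u..w}|lborel. g z) + (LINT z:{w<..v}|lborel. g z)"
      by (simp only:) (intro set_integral_Un Icc set_integrable_subset[OF Icc[of w v]], auto)
    also have "(LINT z:{w<..v}|lborel. g z) = (LINT z:{w..v}|lborel. g z)"
      by (rule set_integral_lborel_sandwich) (use g in auto)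
    finally show ?thesis .
  qed
  fix u v :: real assume "u \<le> v"
  moreover consider "0 \<le> u" | "u < 0" "0 \<le> v" | "v < 0" by linarith
  ultimately show "f v - f u = (LINT z:{u..v}|lborel. g z)"
    using add[of 0 u v] add[of u 0 v] add[of u v 0] f[of u] f[of v] by cases auto
qed (rule g)

theorem proposition4p1:
  fixes x g f :: "real \<Rightarrow> real" and f0 t :: real
  assumes x: "piecewise_monotonic x"
    and g_borel: "g \<in> borel_measurable borel"
    and g_loc_int: "\<And>K. compact K \<Longrightarrow> set_integrable lborel K g"
    and f: "\<And>y. f y = (if y \<ge> 0 then f0 + (LINT z:{0..y}|lborel. g z)
                        else f0 - (LINT z:{y..0}|lborel. g z))"
    and t: "t > 0"
  defines "J \<equiv> {s \<in> {0<..t}. jump x s \<noteq> 0}"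
  shows
    "(AE z in lborel. level_upcross x z 0 t \<noteq> \<infinity> \<and> level_downcross x z 0 t \<noteq> \<infinity>) \<and>
     integrable lborel (\<lambda>z. net_upcross x z 0 t * g z) \<and>
     f (x t) - f (x 0) = (LINT z|lborel. net_upcross x z 0 t * g z)
     \<and>
     (LS_integrable x {0<..t} (\<lambda>s. g (left_lim x s)) \<longrightarrow>
        (\<lambda>s. f (x s) - f (left_lim x s) - g (left_lim x s) * jump x s) summable_on J \<and>
        f (x t) - f (x 0) =
          LS_integral x {0<..t} (\<lambda>s. g (left_lim x s)) +
          (\<Sum>\<^sub>\<infinity>s\<in>J. f (x s) - f (left_lim x s) - g (left_lim x s) * jump x s))
     \<and>
     LS_integrable (cont_part x) {0<..t} (\<lambda>s. g (x s)) \<and>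
     (\<lambda>s. f (x s) - f (left_lim x s)) summable_on J \<and>
     f (x t) - f (x 0) =
       LS_integral (cont_part x) {0<..t} (\<lambda>s. g (x s)) +
       (\<Sum>\<^sub>\<infinity>s\<in>J. f (x s) - f (left_lim x s))
     \<and>
     (AE z in lborel. finite (inc_times x z \<inter> {0<..t}) \<and> finite (dec_times x z \<inter> {0<..t})) \<and>
     integrable lborel (\<lambda>z. local_time x z t * g z) \<and>
     f (x t) - f (x 0) =
       (LINT z|lborel. local_time x z t * g z) +
       (\<Sum>\<^sub>\<infinity>s\<in>J. f (x s) - f (left_lim x s))"
proof -
  have fg: "primitive f g" using g_borel g_loc_int f by (rule primitiveI)
  interpret primitive f g by (rule fg)
  note Q = piecewise_monotonic_change_of_variable[OF x fg order_refl t, unfolded change_of_variable_on_def]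
  let ?L = "LS_integral (cont_part x) {0<..t} (\<lambda>s. g (x s))"

  \<comment> \<open>The signed integral of \<open>g\<close> over the levels between
    \<open>x 0\<close> and \<open>x t\<close>; the integrand is the net number of upcrossings off
    these two levels.\<close>
  have "has_bochner_integral lborel
    (\<lambda>z. indicator {x 0<..<x t} z * g z - indicator {x t<..<x 0} z * g z) (f (x t) - f (x 0))"
  proof -
    have Ioo: "set_integrable lborel {u<..<v} g" for u v
      by (rule integrable_subset_Icc[of _ u v]) auto
    have "(LINT z:{u<..<v}|lborel. g z) = (LINT z:{u..v}|lborel. g z)" for u v
      by (rule set_integral_lborel_sandwich) auto
    moreover have "(LINT z:{u<..<v}|lborel. g z) = 0" if "v \<le> u" for u v :: real
      using that by (simp add: set_lebesgue_integral_def)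
    ultimately have "(LINT z:{x 0<..<x t}|lborel. g z) - (LINT z:{x t<..<x 0}|lborel. g z) = f (x t) - f (x 0)"
      using diff_eq[of "x 0" "x t"] diff_eq[of "x t" "x 0"] by (cases "x 0 \<le> x t") force+
    thus ?thesis using Ioo[of "x 0" "x t"] Ioo[of "x t" "x 0"]
      by (auto simp: has_bochner_integral_iff set_integrable_def set_lebesgue_integral_def)
  qed
  hence net: "has_bochner_integral lborel (\<lambda>z. net_upcross x z 0 t * g z) (f (x t) - f (x 0))"
    by (rule has_bochner_integral_lborel_countable_difference[of _ _ "{x 0, x t}"])
      (simp_all add: net_upcross_piecewise_monotonic(3)[OF x t] left_diff_distrib)
  have AE_net: "AE z in lborel. level_upcross x z 0 t \<noteq> \<infinity> \<and> level_downcross x z 0 t \<noteq> \<infinity>"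
    using AE_lborel_singleton[of "x 0"] AE_lborel_singleton[of "x t"]
    by eventually_elim (use net_upcross_piecewise_monotonic[OF x t] in auto)

  have AE_local: "AE z in lborel. finite (inc_times x z \<inter> {0<..t}) \<and> finite (dec_times x z \<inter> {0<..t})"
  proof -
    obtain X where X: "countable X" and fin: "\<And>z. z \<notin> X \<Longrightarrow> finite (inc_times x z \<inter> {0<..t}) \<and> finite (dec_times x z \<inter> {0<..t})"
      using Q by blast
    from AE_not_in[OF countable_imp_null_set_lborel[OF X]] show ?thesis
      by eventually_elim (use fin in blast)
  qed
  have local: "has_bochner_integral lborel (\<lambda>z. local_time x z t * g z) ?L"
    using Q by (simp add: local_time_def local_time_on_def)

  have restrict: "(h has_sum S) J \<longleftrightarrow> (h has_sum S) {0<..t}"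
    if "\<And>s. jump x s = 0 \<Longrightarrow> h s = 0" for h :: "real \<Rightarrow> real" and S
    using that by (intro has_sum_cong_neutral) (auto simp: J_def)
  have jump0: "x s = left_lim x s" if "jump x s = 0" for s using that by (simp add: jump_def)
  have sum1: "((\<lambda>s. f (x s) - f (left_lim x s)) has_sum (f (x t) - f (x 0) - ?L)) J"
    using Q jump0 by (subst restrict) auto
  have sum2: "((\<lambda>s. f (x s) - f (left_lim x s) - g (left_lim x s) * jump x s) has_sum
    (f (x t) - f (x 0) - LS_integral x {0<..t} (\<lambda>s. g (left_lim x s)))) J"
    if "LS_integrable x {0<..t} (\<lambda>s. g (left_lim x s))"
  proof -
    \<comment> \<open>Subtracting this sum from \<open>sum1\<close> cancels \<open>?L\<close>, and
      only the integral against \<open>x\<close> remains.\<close>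
    have "((\<lambda>s. g (left_lim x s) * jump x s) has_sum
      (LS_integral x {0<..t} (\<lambda>s. g (left_lim x s)) - ?L)) J"
      using Q that by (subst restrict) auto
    from has_sum_add[OF sum1 has_sum_uminusI[OF this]] show ?thesis by (simp add: diff_diff_eq2 add_diff_eq)
  qed
  show ?thesis
    using net AE_net local AE_local Q has_sum_imp_summable[OF sum1] infsumI[OF sum1]
      has_sum_imp_summable[OF sum2] infsumI[OF sum2]
    by (simp add: has_bochner_integral_iff)
qed

end
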